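(* Let $k$ be a field of characteristic $0$ and let $H$ be a connected commutative Hopf algebra over $k$. Then $H$ is isomorphic as an algebra to the polynomial algebra over $k$ in some family of variables.
   Context: The coradical of a Hopf algebra is the sum of all its simple subcoalgebras. A Hopf algebra is connected if its coradical is one-dimensional. The family of variables may be infinite; no finiteness assumption on $H$ is made and $k$ need not be algebraically closed. *)

theory Defs
  imports Complex_Main "HOL-Library.Poly_Mapping"
begin

text \<open>
  Vector spaces over a field \<open>'k\<close> are types with an explicit scalar multiplication, as in the
  locale \<open>vector_space\<close>.  The type \<open>'x \<Rightarrow>\<^sub>0 'k\<close> is the free vector space on \<open>'x\<close>.
\<close>

definition fscale :: "'k::field \<Rightarrow> ('x \<Rightarrow>\<^sub>0 'k) \<Rightarrow> ('x \<Rightarrow>\<^sub>0 'k)"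
  where "fscale c p = Poly_Mapping.map ((*) c) p"

abbreviation pure :: "'x \<Rightarrow> ('x \<Rightarrow>\<^sub>0 'k::field)"
  where "pure x \<equiv> Poly_Mapping.single x 1"

text \<open>The linear extension of \<open>f\<close> from the basis \<open>'x\<close> to the free vector space.\<close>

definition lin_ext ::
    "('k::field \<Rightarrow> 'v::ab_group_add \<Rightarrow> 'v) \<Rightarrow> ('x \<Rightarrow> 'v) \<Rightarrow> ('x \<Rightarrow>\<^sub>0 'k) \<Rightarrow> 'v"
  where "lin_ext scale f p =
    (\<Sum>x\<in>Poly_Mapping.keys p. scale (Poly_Mapping.lookup p x) (f x))"


subsection \<open>Tensor powers\<close>

text \<open>
  \<open>H \<otimes> H\<close> is the quotient of the free vector space on \<open>H \<times> H\<close> by the span of the bilinearity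
  relations, and \<open>H \<otimes> H \<otimes> H\<close> (identified with both \<open>(H \<otimes> H) \<otimes> H\<close> and \<open>H \<otimes> (H \<otimes> H)\<close>) is the
  quotient of the free vector space on \<open>H \<times> H \<times> H\<close> by the span of the trilinearity relations.
\<close>

inductive_set bilinear_relations ::
    "('k::field \<Rightarrow> 'h::ab_group_add \<Rightarrow> 'h) \<Rightarrow> ('h \<times> 'h \<Rightarrow>\<^sub>0 'k) set"
  for scale :: "'k \<Rightarrow> 'h \<Rightarrow> 'h"
  where
    "pure (a + a', b) - pure (a, b) - pure (a', b) \<in> bilinear_relations scale"
  | "pure (a, b + b') - pure (a, b) - pure (a, b') \<in> bilinear_relations scale"
  | "pure (scale c a, b) - fscale c (pure (a, b)) \<in> bilinear_relations scale"
  | "pure (a, scale c b) - fscale c (pure (a, b)) \<in> bilinear_relations scale"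

inductive_set trilinear_relations ::
    "('k::field \<Rightarrow> 'h::ab_group_add \<Rightarrow> 'h) \<Rightarrow> ('h \<times> 'h \<times> 'h \<Rightarrow>\<^sub>0 'k) set"
  for scale :: "'k \<Rightarrow> 'h \<Rightarrow> 'h"
  where
    "pure (a + a', b, d) - pure (a, b, d) - pure (a', b, d) \<in> trilinear_relations scale"
  | "pure (a, b + b', d) - pure (a, b, d) - pure (a, b', d) \<in> trilinear_relations scale"
  | "pure (a, b, d + d') - pure (a, b, d) - pure (a, b, d') \<in> trilinear_relations scale"
  | "pure (scale c a, b, d) - fscale c (pure (a, b, d)) \<in> trilinear_relations scale"
  | "pure (a, scale c b, d) - fscale c (pure (a, b, d)) \<in> trilinear_relations scale"
  | "pure (a, b, scale c d) - fscale c (pure (a, b, d)) \<in> trilinear_relations scale"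

definition tensor2_eq ::
    "('k::field \<Rightarrow> 'h::ab_group_add \<Rightarrow> 'h) \<Rightarrow> (('h \<times> 'h \<Rightarrow>\<^sub>0 'k) \<times> ('h \<times> 'h \<Rightarrow>\<^sub>0 'k)) set"
  where "tensor2_eq scale = {(p, q). p - q \<in> module.span fscale (bilinear_relations scale)}"

definition tensor3_eq ::
    "('k::field \<Rightarrow> 'h::ab_group_add \<Rightarrow> 'h) \<Rightarrow>
      (('h \<times> 'h \<times> 'h \<Rightarrow>\<^sub>0 'k) \<times> ('h \<times> 'h \<times> 'h \<Rightarrow>\<^sub>0 'k)) set"
  where "tensor3_eq scale = {(p, q). p - q \<in> module.span fscale (trilinear_relations scale)}"

text \<open>Elements of \<open>H \<otimes> H\<close> are the cosets; \<open>p \<in> t\<close> says that the formal sum \<open>p\<close> represents \<open>t\<close>.\<close>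

definition tensor_square ::
    "('k::field \<Rightarrow> 'h::ab_group_add \<Rightarrow> 'h) \<Rightarrow> ('h \<times> 'h \<Rightarrow>\<^sub>0 'k) set set"
  where "tensor_square scale = UNIV // tensor2_eq scale"

text \<open>
  On representatives: \<open>(a \<otimes> b)(c \<otimes> d) = ac \<otimes> bd\<close>, and the maps \<open>D \<otimes> id\<close>, \<open>id \<otimes> D\<close> from
  \<open>H \<otimes> H\<close> to \<open>H \<otimes> H \<otimes> H\<close>, where \<open>D a\<close> is a representative of an element of \<open>H \<otimes> H\<close>.
\<close>

definition tensor_mult ::
    "('h::times \<times> 'h \<Rightarrow>\<^sub>0 'k::field) \<Rightarrow> ('h \<times> 'h \<Rightarrow>\<^sub>0 'k) \<Rightarrow> ('h \<times> 'h \<Rightarrow>\<^sub>0 'k)"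
  where "tensor_mult p q =
    lin_ext fscale (\<lambda>(a, b). lin_ext fscale (\<lambda>(c, d). pure (a * c, b * d)) q) p"

definition tensor_left ::
    "('h \<Rightarrow> ('h \<times> 'h \<Rightarrow>\<^sub>0 'k::field)) \<Rightarrow> ('h \<times> 'h \<Rightarrow>\<^sub>0 'k) \<Rightarrow> ('h \<times> 'h \<times> 'h \<Rightarrow>\<^sub>0 'k)"
  where "tensor_left D p =
    lin_ext fscale (\<lambda>(a, b). lin_ext fscale (\<lambda>(c, d). pure (c, d, b)) (D a)) p"

definition tensor_right ::
    "('h \<Rightarrow> ('h \<times> 'h \<Rightarrow>\<^sub>0 'k::field)) \<Rightarrow> ('h \<times> 'h \<Rightarrow>\<^sub>0 'k) \<Rightarrow> ('h \<times> 'h \<times> 'h \<Rightarrow>\<^sub>0 'k)"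
  where "tensor_right D p =
    lin_ext fscale (\<lambda>(a, b). lin_ext fscale (\<lambda>(c, d). pure (a, c, d)) (D b)) p"


subsection \<open>Hopf algebras\<close>

text \<open>
  The comultiplication \<open>\<Delta>\<close> takes values in the quotient \<open>H \<otimes> H\<close>, so \<open>p \<in> \<Delta> x\<close> reads
  ``\<open>\<Delta>(x)\<close> is the class of the formal sum \<open>p\<close>'', as in Sweedler notation.  All conditions
  below are independent of the choice of representatives.
\<close>

locale coalgebra = vector_space scale
  for scale :: "'k::field \<Rightarrow> 'h::ab_group_add \<Rightarrow> 'h" +
  fixes \<Delta> :: "'h \<Rightarrow> ('h \<times> 'h \<Rightarrow>\<^sub>0 'k) set"
    and \<epsilon> :: "'h \<Rightarrow> 'k"
  assumes comult_tensor: "\<Delta> x \<in> tensor_square scale"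
    and comult_add: "p \<in> \<Delta> x \<Longrightarrow> q \<in> \<Delta> y \<Longrightarrow> p + q \<in> \<Delta> (x + y)"
    and comult_scale: "p \<in> \<Delta> x \<Longrightarrow> fscale c p \<in> \<Delta> (scale c x)"
    and counit_linear: "Vector_Spaces.linear scale (*) \<epsilon>"
    and coassoc: "(\<And>a. D a \<in> \<Delta> a) \<Longrightarrow> p \<in> \<Delta> x \<Longrightarrow>
      (tensor_left D p, tensor_right D p) \<in> tensor3_eq scale"
    and counit_left: "p \<in> \<Delta> x \<Longrightarrow> lin_ext scale (\<lambda>(a, b). scale (\<epsilon> a) b) p = x"
    and counit_right: "p \<in> \<Delta> x \<Longrightarrow> lin_ext scale (\<lambda>(a, b). scale (\<epsilon> b) a) p = x"

locale unital_algebra = vector_space scale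
  for scale :: "'k::field \<Rightarrow> 'h::ring_1 \<Rightarrow> 'h" +
  assumes scale_mult_left: "scale c x * y = scale c (x * y)"
    and scale_mult_right: "x * scale c y = scale c (x * y)"

locale bialgebra = unital_algebra scale + coalgebra scale \<Delta> \<epsilon>
  for scale :: "'k::field \<Rightarrow> 'h::ring_1 \<Rightarrow> 'h"
    and \<Delta> :: "'h \<Rightarrow> ('h \<times> 'h \<Rightarrow>\<^sub>0 'k) set"
    and \<epsilon> :: "'h \<Rightarrow> 'k" +
  assumes comult_mult: "p \<in> \<Delta> x \<Longrightarrow> q \<in> \<Delta> y \<Longrightarrow> tensor_mult p q \<in> \<Delta> (x * y)"
    and comult_one: "pure (1, 1) \<in> \<Delta> 1"
    and counit_mult: "\<epsilon> (x * y) = \<epsilon> x * \<epsilon> y"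
    and counit_one: "\<epsilon> 1 = 1"

locale hopf_algebra = bialgebra scale \<Delta> \<epsilon>
  for scale :: "'k::field \<Rightarrow> 'h::ring_1 \<Rightarrow> 'h"
    and \<Delta> :: "'h \<Rightarrow> ('h \<times> 'h \<Rightarrow>\<^sub>0 'k) set"
    and \<epsilon> :: "'h \<Rightarrow> 'k" +
  fixes S :: "'h \<Rightarrow> 'h"
  assumes antipode_linear: "Vector_Spaces.linear scale scale S"
    and antipode_left: "p \<in> \<Delta> x \<Longrightarrow> lin_ext scale (\<lambda>(a, b). S a * b) p = scale (\<epsilon> x) 1"
    and antipode_right: "p \<in> \<Delta> x \<Longrightarrow> lin_ext scale (\<lambda>(a, b). a * S b) p = scale (\<epsilon> x) 1"


subsection \<open>The coradical\<close>

text \<open>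
  The condition \<open>\<Delta>(C) \<subseteq> C \<otimes> C\<close>: the subspace \<open>C \<otimes> C\<close> of \<open>H \<otimes> H\<close> consists of the classes of
  formal sums supported on \<open>C \<times> C\<close>.
\<close>

definition subcoalgebra ::
    "('k::field \<Rightarrow> 'h::ab_group_add \<Rightarrow> 'h) \<Rightarrow> ('h \<Rightarrow> ('h \<times> 'h \<Rightarrow>\<^sub>0 'k) set) \<Rightarrow> 'h set \<Rightarrow> bool"
  where "subcoalgebra scale \<Delta> C \<longleftrightarrow>
    module.subspace scale C \<and> (\<forall>x\<in>C. \<exists>p\<in>\<Delta> x. Poly_Mapping.keys p \<subseteq> C \<times> C)"

definition simple_subcoalgebra ::
    "('k::field \<Rightarrow> 'h::ab_group_add \<Rightarrow> 'h) \<Rightarrow> ('h \<Rightarrow> ('h \<times> 'h \<Rightarrow>\<^sub>0 'k) set) \<Rightarrow> 'h set \<Rightarrow> bool"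
  where "simple_subcoalgebra scale \<Delta> C \<longleftrightarrow>
    subcoalgebra scale \<Delta> C \<and> C \<noteq> {0} \<and>
    (\<forall>D. subcoalgebra scale \<Delta> D \<and> D \<subseteq> C \<longrightarrow> D = {0} \<or> D = C)"

definition coradical ::
    "('k::field \<Rightarrow> 'h::ab_group_add \<Rightarrow> 'h) \<Rightarrow> ('h \<Rightarrow> ('h \<times> 'h \<Rightarrow>\<^sub>0 'k) set) \<Rightarrow> 'h set"
  where "coradical scale \<Delta> = module.span scale (\<Union>{C. simple_subcoalgebra scale \<Delta> C})"

text \<open>\<open>dim\<close> is \<open>0\<close> on infinite-dimensional subspaces, so \<open>dim = 1\<close> does mean one-dimensional.\<close>

definition connected_coalgebra ::
    "('k::field \<Rightarrow> 'h::ab_group_add \<Rightarrow> 'h) \<Rightarrow> ('h \<Rightarrow> ('h \<times> 'h \<Rightarrow>\<^sub>0 'k) set) \<Rightarrow> bool"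
  where "connected_coalgebra scale \<Delta> \<longleftrightarrow> vector_space.dim scale (coradical scale \<Delta>) = 1"


subsection \<open>Polynomial algebras\<close>

text \<open>
  The polynomial algebra on the family of variables indexed by the set \<open>X\<close>: \<open>'x \<Rightarrow>\<^sub>0 nat\<close> is the
  type of monomials, and \<open>('x \<Rightarrow>\<^sub>0 nat) \<Rightarrow>\<^sub>0 'k\<close> with the convolution product of
  \<open>Poly_Mapping\<close> is the polynomial ring in variables indexed by all of \<open>'x\<close>.  An algebra \<open>'h\<close> isomorphic to a polynomial
  algebra contains a copy of its variables, so taking \<open>X :: 'h set\<close> is no restriction on the
  family; the isomorphism need not send the variable indexed by \<open>x\<close> to \<open>x\<close>.
\<close>

definition polynomials_in :: "'x set \<Rightarrow> (('x \<Rightarrow>\<^sub>0 nat) \<Rightarrow>\<^sub>0 'k::field) set"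
  where "polynomials_in X = {p. \<forall>m\<in>Poly_Mapping.keys p. Poly_Mapping.keys m \<subseteq> X}"

definition algebra_iso_polynomials ::
    "('k::field \<Rightarrow> 'h::ring_1 \<Rightarrow> 'h) \<Rightarrow> 'x set \<Rightarrow> ((('x \<Rightarrow>\<^sub>0 nat) \<Rightarrow>\<^sub>0 'k) \<Rightarrow> 'h) \<Rightarrow> bool"
  where "algebra_iso_polynomials scale X \<phi> \<longleftrightarrow>
    bij_betw \<phi> (polynomials_in X) UNIV \<and>
    \<phi> 1 = 1 \<and>
    (\<forall>p\<in>polynomials_in X. \<forall>q\<in>polynomials_in X. \<phi> (p + q) = \<phi> p + \<phi> q) \<and>
    (\<forall>p\<in>polynomials_in X. \<forall>q\<in>polynomials_in X. \<phi> (p * q) = \<phi> p * \<phi> q) \<and>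
    (\<forall>c. \<forall>p\<in>polynomials_in X. \<phi> (fscale c p) = scale c (\<phi> p))"

end

theory Submission
  imports Defs
    "HOL-Computational_Algebra.Formal_Power_Series"
    "HOL-Computational_Algebra.Polynomial"
begin

text \<open>
  The theorem follows Leray's structure theorem for commutative Hopf algebras, in the version for
  conilpotent ones, and rests on the logarithm of the identity map (the first Eulerian idempotent).  Linear maps from \<open>H\<close> to a commutative algebra form a monoid
  under the convolution \<open>(f * g)(x) = \<Sum> f(x\<^sub>1) g(x\<^sub>2)\<close>, whose unit is \<open>\<epsilon>\<close> followed by
  \<open>c \<mapsto> c\<cdot>1\<close>.

  \<^item> Connectedness makes \<open>H\<close> conilpotent: if \<open>f(1) = 0\<close>, then for every \<open>x\<close> the convolution powers
    \<open>f\<^sup>n(x)\<close> vanish for large \<open>n\<close>.  The idea is that a finite-dimensional right coideal \<open>M\<close> with a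
    maximal proper subcoideal \<open>N\<close> gives rise to a finite-dimensional subcoalgebra, made of the
    coefficients of \<open>M / N\<close>.  It contains a simple subcoalgebra, hence \<open>1\<close>, and this forces \<open>M / N\<close>
    to be the trivial comodule (lemma \<open>augmentation_kills_maximal_quotient\<close>).  So every
    composition factor of a finite-dimensional coideal is trivial.

  \<^item> Consequently a power series can be evaluated at \<open>J = id - unit\<close>.  Put \<open>e = log(1 + J)\<close>.  For
    every natural number \<open>t\<close> the power \<open>id\<^sup>t = exp(t e)\<close> is multiplicative because \<open>H\<close> is commutative,
    and \<open>id\<^sup>t(x)\<close> is a polynomial in \<open>t\<close> with linear coefficient \<open>e(x)\<close>.  Comparing linear
    coefficients, in characteristic 0, shows that \<open>e(xy) = \<epsilon>(x) e(y) + e(x) \<epsilon>(y)\<close>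
    (lemma \<open>log_id_derivation\<close>).  So \<open>e\<close> kills products of two elements of \<open>ker \<epsilon>\<close>.
    Applied to \<open>x = exp(e)(x)\<close>, this shows that \<open>e\<close> is a projection onto its range \<open>V\<close>.

  \<^item> \<open>V\<close> generates \<open>H\<close>, since \<open>x = \<Sum> e\<^sup>n(x) / n!\<close> and \<open>e\<^sup>n(x)\<close> is a sum of products of elements
    of \<open>V\<close> (lemma \<open>poly_eval_surjective\<close>).

  \<^item> A basis \<open>B\<close> of \<open>V\<close> is algebraically independent.  Compose \<open>e\<close> with the linear map that sends each
    \<open>b \<in> B\<close> to the corresponding variable; the result \<open>\<delta>\<close> is again a derivation, with values in the
    polynomial algebra.  By the Leibniz rule \<open>\<delta>\<^sup>n\<close> sends the value of a monomial of degree \<open>n\<close> to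
    \<open>n!\<close> times this monomial, and the values of monomials of larger degree to \<open>0\<close>.  Hence \<open>\<delta>\<^sup>n\<close>
    recovers the component of lowest degree \<open>n\<close> of a polynomial from its value in \<open>H\<close>
    (lemma \<open>poly_eval_kernel\<close>).
\<close>

section \<open>Free vector spaces and multilinear maps\<close>

lemma lookup_fscale [simp]: "Poly_Mapping.lookup (fscale c p) x = c * Poly_Mapping.lookup p x"
  unfolding fscale_def by (simp add: Poly_Mapping.map.rep_eq when_def)

lemma vector_space_fscale [simp]: "vector_space (fscale :: 'k::field \<Rightarrow> ('x \<Rightarrow>\<^sub>0 'k) \<Rightarrow> _)"
  by standard (auto intro!: poly_mapping_eqI simp: lookup_add algebra_simps)

lemma vector_space_mult [simp]: "vector_space ((*) :: 'k::field \<Rightarrow> 'k \<Rightarrow> 'k)"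
  by standard (auto simp: algebra_simps)

definition bilinear_map ::
    "('k::field \<Rightarrow> 'h::ab_group_add \<Rightarrow> 'h) \<Rightarrow> ('k \<Rightarrow> 'v::ab_group_add \<Rightarrow> 'v) \<Rightarrow>
      ('h \<Rightarrow> 'h \<Rightarrow> 'v) \<Rightarrow> bool"
  where "bilinear_map s t \<beta> \<longleftrightarrow>
    (\<forall>a. Vector_Spaces.linear s t (\<beta> a)) \<and> (\<forall>b. Vector_Spaces.linear s t (\<lambda>a. \<beta> a b))"

definition trilinear_map ::
    "('k::field \<Rightarrow> 'h::ab_group_add \<Rightarrow> 'h) \<Rightarrow> ('k \<Rightarrow> 'v::ab_group_add \<Rightarrow> 'v) \<Rightarrow>
      ('h \<Rightarrow> 'h \<Rightarrow> 'h \<Rightarrow> 'v) \<Rightarrow> bool"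
  where "trilinear_map s t \<tau> \<longleftrightarrow>
    (\<forall>a b. Vector_Spaces.linear s t (\<tau> a b)) \<and>
    (\<forall>a c. Vector_Spaces.linear s t (\<lambda>b. \<tau> a b c)) \<and>
    (\<forall>b c. Vector_Spaces.linear s t (\<lambda>a. \<tau> a b c))"

context vector_space
begin

lemma lin_ext_superset:
  assumes "finite A" "Poly_Mapping.keys p \<subseteq> A"
  shows "lin_ext scale f p = (\<Sum>x\<in>A. scale (Poly_Mapping.lookup p x) (f x))"
  unfolding lin_ext_def using assms
  by (intro sum.mono_neutral_left) (auto simp: in_keys_iff)

lemma lin_ext_add: "lin_ext scale f (p + q) = lin_ext scale f p + lin_ext scale f q"
proof -
  let ?A = "Poly_Mapping.keys p \<union> Poly_Mapping.keys q"
  have "Poly_Mapping.keys (p + q) \<subseteq> ?A" by (rule keys_add)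
  then show ?thesis
    by (simp add: lin_ext_superset[of ?A] lookup_add scale_left_distrib sum.distrib)
qed

lemma lin_ext_fscale: "lin_ext scale f (fscale c p) = scale c (lin_ext scale f p)"
proof -
  have "Poly_Mapping.keys (fscale c p) \<subseteq> Poly_Mapping.keys p"
    by (auto simp: in_keys_iff)
  then show ?thesis
    by (simp add: lin_ext_superset[of "Poly_Mapping.keys p"] scale_sum_right)
qed

lemma linear_lin_ext [simp]: "Vector_Spaces.linear fscale scale (lin_ext scale f)"
  by (simp add: Vector_Spaces.linear_iff lin_ext_add lin_ext_fscale vector_space_axioms)

lemma lin_ext_single [simp]: "lin_ext scale f (Poly_Mapping.single x c) = scale c (f x)"
  by (simp add: lin_ext_def)

lemma lin_ext_diff: "lin_ext scale f (p - q) = lin_ext scale f p - lin_ext scale f q"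
  by (metis add_diff_cancel_right' diff_add_cancel lin_ext_add)

lemma lin_ext_zero [simp]: "lin_ext scale f 0 = 0"
  by (simp add: lin_ext_def)

lemma lin_ext_fun_add:
  "lin_ext scale (\<lambda>x. f x + g x) p = lin_ext scale f p + lin_ext scale g p"
  by (simp add: lin_ext_def scale_right_distrib sum.distrib)

lemma lin_ext_fun_scale: "lin_ext scale (\<lambda>x. scale c (f x)) p = scale c (lin_ext scale f p)"
  by (simp add: lin_ext_def scale_sum_right scale_left_commute mult.commute)

lemma lin_ext_in_subspace:
  assumes "subspace U" "\<And>x. x \<in> Poly_Mapping.keys p \<Longrightarrow> f x \<in> U"
  shows "lin_ext scale f p \<in> U"
  unfolding lin_ext_def using assms by (intro subspace_sum) (auto intro: subspace_scale)

text \<open>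
  The next two lemmas are the universal properties of \<open>H \<otimes> H\<close> and \<open>H \<otimes> H \<otimes> H\<close>: a multilinear map
  depends only on the class of a formal sum.
\<close>

lemma lin_ext_bilinear_zero:
  assumes \<beta>: "bilinear_map s scale \<beta>" and p: "p \<in> module.span fscale (bilinear_relations s)"
  shows "lin_ext scale (\<lambda>(a, b). \<beta> a b) p = 0"
proof -
  interpret F: vector_space "fscale :: 'a \<Rightarrow> ('c \<times> 'c \<Rightarrow>\<^sub>0 'a) \<Rightarrow> _" by simp
  have "F.subspace {p. lin_ext scale (\<lambda>(a, b). \<beta> a b) p = 0}"
    by (auto simp: F.subspace_def lin_ext_add lin_ext_fscale)
  moreover have "bilinear_relations s \<subseteq> {p. lin_ext scale (\<lambda>(a, b). \<beta> a b) p = 0}"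
    using \<beta> by (auto elim!: bilinear_relations.cases
        simp: lin_ext_diff lin_ext_fscale bilinear_map_def Vector_Spaces.linear_iff)
  ultimately show ?thesis
    using p F.span_minimal by blast
qed

lemma lin_ext_trilinear_zero:
  assumes \<tau>: "trilinear_map s scale \<tau>" and p: "p \<in> module.span fscale (trilinear_relations s)"
  shows "lin_ext scale (\<lambda>(a, b, c). \<tau> a b c) p = 0"
proof -
  interpret F: vector_space "fscale :: 'a \<Rightarrow> ('c \<times> 'c \<times> 'c \<Rightarrow>\<^sub>0 'a) \<Rightarrow> _" by simp
  have "F.subspace {p. lin_ext scale (\<lambda>(a, b, c). \<tau> a b c) p = 0}"
    by (auto simp: F.subspace_def lin_ext_add lin_ext_fscale)
  moreover have "trilinear_relations s \<subseteq> {p. lin_ext scale (\<lambda>(a, b, c). \<tau> a b c) p = 0}"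
    using \<tau> by (auto elim!: trilinear_relations.cases
        simp: lin_ext_diff lin_ext_fscale trilinear_map_def Vector_Spaces.linear_iff)
  ultimately show ?thesis
    using p F.span_minimal by blast
qed

end

lemma linear_of_lin_ext:
  assumes "Vector_Spaces.linear s t f"
  shows "f (lin_ext s g p) = lin_ext t (\<lambda>x. f (g x)) p"
proof -
  interpret Vector_Spaces.linear s t f by fact
  show ?thesis by (simp add: lin_ext_def sum scale)
qed

lemma linear_free_eq:
  assumes "Vector_Spaces.linear fscale t f"
  shows "f p = lin_ext t (\<lambda>x. f (pure x)) p"
proof -
  have "lin_ext fscale pure p = p"
    by (rule poly_mapping_eqI)
      (auto simp: lin_ext_def lookup_sum lookup_single when_def in_keys_iff if_distrib cong: if_cong)
  then show ?thesis using linear_of_lin_ext[OF assms, of pure p] by simp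
qed

lemma linear_free_ext:
  assumes "Vector_Spaces.linear fscale t f" "Vector_Spaces.linear fscale t g"
    and "\<And>x. f (pure x) = g (pure x)"
  shows "f p = g p"
  using linear_free_eq[OF assms(1), of p] linear_free_eq[OF assms(2), of p] assms(3) by simp

lemma lin_ext_fun_sum:
  assumes "vector_space s"
  shows "lin_ext s (\<lambda>x. \<Sum>i\<in>I. f i x) p = (\<Sum>i\<in>I. lin_ext s (f i) p)"
proof -
  interpret vector_space s by fact
  show ?thesis
    unfolding lin_ext_def scale_sum_right by (rule sum.swap)
qed


section \<open>Sweedler sums\<close>

text \<open>
  \<open>sweedler t \<beta> x\<close> is \<open>\<Sum> \<beta> x\<^sub>1 x\<^sub>2\<close> in Sweedler notation, where \<open>t\<close> is the scalar multiplication
  of the target.  It is computed on one chosen representative of \<open>\<Delta> x\<close>; for bilinear \<open>\<beta>\<close> the choice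
  is irrelevant (lemma \<open>sweedler_eq\<close>).  The axioms of a bialgebra are transported to such sums here,
  so that representatives can be avoided afterwards.
\<close>

context coalgebra
begin

definition comult_rep :: "'h \<Rightarrow> ('h \<times> 'h \<Rightarrow>\<^sub>0 'k)"
  where "comult_rep x = (SOME p. p \<in> \<Delta> x)"

definition sweedler ::
    "('k \<Rightarrow> 'v::ab_group_add \<Rightarrow> 'v) \<Rightarrow> ('h \<Rightarrow> 'h \<Rightarrow> 'v) \<Rightarrow> 'h \<Rightarrow> 'v"
  where "sweedler t \<beta> x = lin_ext t (\<lambda>(a, b). \<beta> a b) (comult_rep x)"

lemma vector_space_scale [simp]: "vector_space scale"
  by (rule vector_space_axioms)

lemma equiv_tensor2_eq: "equiv UNIV (tensor2_eq scale)"
proof -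
  interpret F: vector_space "fscale :: 'k \<Rightarrow> ('h \<times> 'h \<Rightarrow>\<^sub>0 'k) \<Rightarrow> _" by simp
  show ?thesis
  proof (rule equivI)
    show "tensor2_eq scale \<subseteq> UNIV \<times> UNIV" by simp
    show "refl_on UNIV (tensor2_eq scale)"
      by (auto simp: refl_on_def tensor2_eq_def F.span_zero)
    show "sym (tensor2_eq scale)"
      unfolding sym_def tensor2_eq_def using F.span_neg by force
    show "trans (tensor2_eq scale)"
      unfolding trans_def tensor2_eq_def using F.span_add by force
  qed
qed

lemma comult_nonempty: "\<exists>p. p \<in> \<Delta> x"
  using comult_tensor[of x] in_quotient_imp_non_empty[OF equiv_tensor2_eq]
  by (auto simp: tensor_square_def)

lemma comult_rep_in [simp]: "comult_rep x \<in> \<Delta> x"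
  unfolding comult_rep_def using comult_nonempty by (rule someI_ex)

lemma comult_eqD:
  "p \<in> \<Delta> x \<Longrightarrow> q \<in> \<Delta> x \<Longrightarrow> p - q \<in> module.span fscale (bilinear_relations scale)"
  using comult_tensor[of x] quotient_eq_iff[OF equiv_tensor2_eq, of "\<Delta> x" "\<Delta> x" p q]
  by (auto simp: tensor_square_def tensor2_eq_def)

lemma comult_eqI:
  assumes "p \<in> \<Delta> x" "p - q \<in> module.span fscale (bilinear_relations scale)"
  shows "q \<in> \<Delta> x"
  using assms comult_tensor[of x] in_quotient_imp_closed[OF equiv_tensor2_eq, of "\<Delta> x" p q]
  by (auto simp: tensor_square_def tensor2_eq_def)

lemma sweedler_eq:
  assumes t: "vector_space t" and \<beta>: "bilinear_map scale t \<beta>" and p: "p \<in> \<Delta> x"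
  shows "sweedler t \<beta> x = lin_ext t (\<lambda>(a, b). \<beta> a b) p"
proof -
  interpret t: vector_space t by fact
  show ?thesis
    using t.lin_ext_bilinear_zero[OF \<beta> comult_eqD[OF comult_rep_in p]]
    by (simp add: sweedler_def t.lin_ext_diff)
qed

lemma sweedler_linear:
  assumes t: "vector_space t" and \<beta>: "bilinear_map scale t \<beta>"
  shows "Vector_Spaces.linear scale t (sweedler t \<beta>)"
proof -
  interpret t: vector_space t by fact
  have "sweedler t \<beta> (x + y) = sweedler t \<beta> x + sweedler t \<beta> y" for x y
    using sweedler_eq[OF t \<beta> comult_add[OF comult_rep_in comult_rep_in]]
    by (simp add: sweedler_def t.lin_ext_add)
  moreover have "sweedler t \<beta> (scale c x) = t c (sweedler t \<beta> x)" for c x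
    using sweedler_eq[OF t \<beta> comult_scale[OF comult_rep_in]]
    by (simp add: sweedler_def t.lin_ext_fscale)
  ultimately show ?thesis by (simp add: Vector_Spaces.linear_iff t)
qed

lemma linear_sweedler:
  "Vector_Spaces.linear t u f \<Longrightarrow> f (sweedler t \<beta> x) = sweedler u (\<lambda>a b. f (\<beta> a b)) x"
  by (simp add: sweedler_def linear_of_lin_ext split_def)

lemma sweedler_fun_add:
  "vector_space t \<Longrightarrow> sweedler t (\<lambda>a b. \<beta> a b + \<gamma> a b) x = sweedler t \<beta> x + sweedler t \<gamma> x"
  by (simp add: sweedler_def split_def vector_space.lin_ext_fun_add)

lemma sweedler_fun_scale:
  "vector_space t \<Longrightarrow> sweedler t (\<lambda>a b. t c (\<beta> a b)) x = t c (sweedler t \<beta> x)"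
  unfolding sweedler_def split_def by (rule vector_space.lin_ext_fun_scale)

lemma sweedler_fun_sum:
  "vector_space t \<Longrightarrow> sweedler t (\<lambda>a b. \<Sum>i\<in>I. \<beta> i a b) x = (\<Sum>i\<in>I. sweedler t (\<beta> i) x)"
  by (simp add: sweedler_def split_def lin_ext_fun_sum)

lemma sweedler_counit_left:
  assumes "Vector_Spaces.linear scale t f"
  shows "sweedler t (\<lambda>a b. t (\<epsilon> a) (f b)) x = f x"
proof -
  interpret Vector_Spaces.linear scale t f by fact
  have "f x = f (sweedler scale (\<lambda>a b. scale (\<epsilon> a) b) x)"
    using counit_left[OF comult_rep_in] by (simp add: sweedler_def)
  also have "\<dots> = sweedler t (\<lambda>a b. t (\<epsilon> a) (f b)) x"
    by (simp add: linear_sweedler[OF assms] scale)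
  finally show ?thesis by simp
qed

lemma sweedler_counit_right:
  assumes "Vector_Spaces.linear scale t f"
  shows "sweedler t (\<lambda>a b. t (\<epsilon> b) (f a)) x = f x"
proof -
  interpret Vector_Spaces.linear scale t f by fact
  have "f x = f (sweedler scale (\<lambda>a b. scale (\<epsilon> b) a) x)"
    using counit_right[OF comult_rep_in] by (simp add: sweedler_def)
  also have "\<dots> = sweedler t (\<lambda>a b. t (\<epsilon> b) (f a)) x"
    by (simp add: linear_sweedler[OF assms] scale)
  finally show ?thesis by simp
qed

lemma sweedler_coassoc:
  assumes t: "vector_space t" and \<tau>: "trilinear_map scale t \<tau>"
  shows "sweedler t (\<lambda>a c. sweedler t (\<lambda>a b. \<tau> a b c) a) x
       = sweedler t (\<lambda>a b. sweedler t (\<lambda>b c. \<tau> a b c) b) x"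
proof -
  interpret t: vector_space t by fact
  let ?T = "lin_ext t (\<lambda>(a, b, c). \<tau> a b c)"
  have "?T (tensor_left comult_rep (comult_rep x)) = ?T (tensor_right comult_rep (comult_rep x))"
    using t.lin_ext_trilinear_zero[OF \<tau>] coassoc[of comult_rep "comult_rep x" x]
    by (fastforce simp: tensor3_eq_def t.lin_ext_diff)
  then show ?thesis
    by (simp add: tensor_left_def tensor_right_def sweedler_def split_def
        linear_of_lin_ext[OF t.linear_lin_ext])
qed

end

context bialgebra
begin

lemma sweedler_mult:
  assumes t: "vector_space t" and \<beta>: "bilinear_map scale t \<beta>"
  shows "sweedler t \<beta> (x * y) = sweedler t (\<lambda>a b. sweedler t (\<lambda>c d. \<beta> (a * c) (b * d)) y) x"
proof -
  interpret t: vector_space t by fact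
  show ?thesis
    using sweedler_eq[OF t \<beta> comult_mult[OF comult_rep_in comult_rep_in]]
    by (simp add: tensor_mult_def sweedler_def split_def
        linear_of_lin_ext[OF t.linear_lin_ext])
qed

lemma sweedler_one:
  assumes t: "vector_space t" and \<beta>: "bilinear_map scale t \<beta>"
  shows "sweedler t \<beta> 1 = \<beta> 1 1"
proof -
  interpret t: vector_space t by fact
  show ?thesis
    using sweedler_eq[OF t \<beta> comult_one] by simp
qed

end

section \<open>Functionals and dimension\<close>

lemma linear_map_zero: "Vector_Spaces.linear s t f \<Longrightarrow> f 0 = 0"
  by (metis Vector_Spaces.linear_iff add_cancel_right_right)

context vector_space
begin

lemma subspace_eq_span_basis:
  assumes "subspace U"
  obtains B where "B \<subseteq> U" "independent B" "span B = U"
  using maximal_independent_subset[of U] span_subspace[OF _ _ assms] by metis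

text \<open>
  Functionals replace elements of tensor products below: enough of them exist to detect whether a
  vector lies in a given subspace.
\<close>

lemma separating_functional:
  assumes U: "subspace U" and x: "x \<notin> U"
  obtains \<phi> where "Vector_Spaces.linear scale (*) \<phi>" "\<And>u. u \<in> U \<Longrightarrow> \<phi> u = 0" "\<phi> x = 1"
proof -
  obtain B where B: "B \<subseteq> U" "independent B" "span B = U"
    using subspace_eq_span_basis[OF U] .
  have ind: "independent (insert x B)"
    using B x by (simp add: independent_insert)
  let ?C = "extend_basis (insert x B)"
  have C: "independent ?C" "span ?C = UNIV" "insert x B \<subseteq> ?C"
    using independent_extend_basis[OF ind] span_extend_basis[OF ind] extend_basis_superset[OF ind]
    by auto
  show thesis
  proof
    show "Vector_Spaces.linear scale (*) (\<lambda>v. representation ?C v x)"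
      by (rule linear_representation[OF C(1,2)])
    show "representation ?C x x = 1"
      using C by (simp add: representation_basis)
    fix u assume "u \<in> U"
    then have "representation ?C u = representation B u"
      using representation_extend[OF C(1)] B C(3) by auto
    then show "representation ?C u x = 0"
      using x B(1) representation_ne_zero[of B u x] by auto
  qed
qed

lemma dim_subspace_mono:
  assumes "U \<subseteq> W" "W \<subseteq> span T" "finite T"
  shows "dim U \<le> dim W"
proof -
  obtain B where B: "B \<subseteq> W" "independent B" "W \<subseteq> span B" "card B = dim W"
    using basis_exists[of W] by blast
  have "finite B"
    using independent_span_bound[OF assms(3) B(2)] B(1) assms(2) by auto
  then show ?thesis
    using dim_le_card[of U B] B assms(1) by auto
qed

lemma dim_subspace_strict_mono:
  assumes U: "subspace U" and W: "subspace W" "U \<subset> W" "W \<subseteq> span T" "finite T"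
  shows "dim U < dim W"
proof -
  obtain B where B: "B \<subseteq> U" "independent B" "span B = U"
    using subspace_eq_span_basis[OF U] .
  obtain x where x: "x \<in> W" "x \<notin> U" using W by auto
  have ind: "independent (insert x B)"
    using B x by (simp add: independent_insert)
  have "insert x B \<subseteq> W" using B W x by auto
  then have "finite B" 
    using independent_span_bound[OF W(4) ind] W(3) by auto
  have "dim U = card B"
    using B by (metis dim_span_eq_card_independent)
  also have "\<dots> < card (insert x B)"
    using \<open>finite B\<close> x B by (subst card_insert_disjoint) auto
  also have "\<dots> = dim (span (insert x B))"
    by (rule dim_span_eq_card_independent[OF ind, symmetric])
  also have "\<dots> \<le> dim W"
    using span_minimal[OF \<open>insert x B \<subseteq> W\<close> W(1)] W(3,4) by (rule dim_subspace_mono)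
  finally show ?thesis .
qed

end

section \<open>Coideals and subcoalgebras\<close>

context coalgebra
begin

abbreviation functional :: "('h \<Rightarrow> 'k) \<Rightarrow> bool"
  where "functional \<equiv> Vector_Spaces.linear scale (*)"

text \<open>
  \<open>contract_right g x = \<Sum> g(x\<^sub>2) x\<^sub>1\<close> and \<open>contract_left g x = \<Sum> g(x\<^sub>1) x\<^sub>2\<close> are the two actions of the
  dual algebra on \<open>H\<close>.  They commute by coassociativity, and turn statements about comodules and
  subcoalgebras into statements about invariant subspaces.
\<close>

definition contract_right :: "('h \<Rightarrow> 'k) \<Rightarrow> 'h \<Rightarrow> 'h"
  where "contract_right g = sweedler scale (\<lambda>a b. scale (g b) a)"

definition contract_left :: "('h \<Rightarrow> 'k) \<Rightarrow> 'h \<Rightarrow> 'h"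
  where "contract_left g = sweedler scale (\<lambda>a b. scale (g a) b)"

lemmas linear_simps = bilinear_map_def trilinear_map_def Vector_Spaces.linear_iff
  scale_left_distrib scale_right_distrib algebra_simps

lemma functional_counit [simp]: "functional \<epsilon>"
  by (rule counit_linear)

lemma bilinear_contract [simp]:
  assumes "functional g"
  shows "bilinear_map scale scale (\<lambda>a b. scale (g b) a)"
    and "bilinear_map scale scale (\<lambda>a b. scale (g a) b)"
  using assms by (auto simp: linear_simps)

lemma linear_contract:
  assumes "functional g"
  shows "Vector_Spaces.linear scale scale (contract_right g)"
    and "Vector_Spaces.linear scale scale (contract_left g)"
  using assms by (simp_all add: contract_right_def contract_left_def sweedler_linear)

lemma contract_counit [simp]: "contract_right \<epsilon> x = x" "contract_left \<epsilon> x = x"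
  using sweedler_counit_right[OF linear_ident] sweedler_counit_left[OF linear_ident]
  by (simp_all add: contract_right_def contract_left_def)

lemma functional_contract_right:
  assumes "functional f"
  shows "f (contract_right g x) = sweedler (*) (\<lambda>a b. f a * g b) x"
proof -
  have "f (scale (g b) a) = f a * g b" for a b
    using assms by (simp add: Vector_Spaces.linear_iff mult.commute)
  then show ?thesis
    unfolding contract_right_def using linear_sweedler[OF assms] by simp
qed

lemma functional_contract_left:
  assumes "functional f"
  shows "f (contract_left g x) = sweedler (*) (\<lambda>a b. g a * f b) x"
proof -
  have "f (scale (g a) b) = g a * f b" for a b
    using assms by (simp add: Vector_Spaces.linear_iff mult.commute)
  then show ?thesis
    unfolding contract_left_def using linear_sweedler[OF assms] by simp
qed

text \<open>
  Both sides are \<open>\<Sum> f(x\<^sub>1) g(x\<^sub>2)\<close>: the two actions are adjoint to each other.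
\<close>

lemma functional_contract_swap:
  "functional f \<Longrightarrow> functional g \<Longrightarrow> f (contract_right g x) = g (contract_left f x)"
  by (simp add: functional_contract_right functional_contract_left)

lemma functional_comp_contract:
  assumes "functional f" "functional g"
  shows "functional (\<lambda>x. f (contract_right g x))" "functional (\<lambda>x. f (contract_left g x))"
  using linear_contract[OF assms(2)] assms(1) by (simp_all add: Vector_Spaces.linear_iff)

lemma contract_commute:
  assumes f: "functional f" and g: "functional g"
  shows "contract_right g (contract_left f x) = contract_left f (contract_right g x)"
proof -
  have \<tau>: "trilinear_map scale scale (\<lambda>a b c. scale (f a * g c) b)"
    using f g by (auto simp: linear_simps)
  have "contract_right g (contract_left f x) =
      sweedler scale (\<lambda>a b. scale (f a) (contract_right g b)) x"
    unfolding contract_left_def using linear_contract(1)[OF g]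
    by (subst linear_sweedler[OF linear_contract(1)[OF g]]) (simp add: Vector_Spaces.linear_iff)
  also have "\<dots> = sweedler scale (\<lambda>a b. sweedler scale (\<lambda>b c. scale (f a * g c) b) b) x"
    unfolding contract_right_def by (simp flip: sweedler_fun_scale)
  also have "\<dots> = sweedler scale (\<lambda>a c. sweedler scale (\<lambda>a b. scale (f a * g c) b) a) x"
    by (rule sweedler_coassoc[OF vector_space_scale \<tau>, symmetric])
  also have "\<dots> = sweedler scale (\<lambda>a c. scale (g c) (contract_left f a)) x"
    unfolding contract_left_def by (simp add: mult.commute flip: sweedler_fun_scale)
  also have "\<dots> = contract_left f (contract_right g x)"
    unfolding contract_right_def using linear_contract(2)[OF f]
    by (subst linear_sweedler[OF linear_contract(2)[OF f]]) (simp add: Vector_Spaces.linear_iff)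
  finally show ?thesis .
qed

lemma contract_right_comp:
  assumes f: "functional f" and g: "functional g"
  shows "contract_right g (contract_right f x) = contract_right (\<lambda>b. g (contract_right f b)) x"
proof -
  have \<tau>: "trilinear_map scale scale (\<lambda>a b c. scale (g b * f c) a)"
    using f g by (auto simp: linear_simps)
  have \<phi>: "Vector_Spaces.linear (*) scale (\<lambda>c. scale c a)" for a
    by (simp add: linear_simps)
  have "contract_right g (contract_right f x) =
      sweedler scale (\<lambda>a c. scale (f c) (contract_right g a)) x"
    unfolding contract_right_def[of f] using linear_contract(1)[OF g]
    by (subst linear_sweedler[OF linear_contract(1)[OF g]]) (simp add: Vector_Spaces.linear_iff)
  also have "\<dots> = sweedler scale (\<lambda>a c. sweedler scale (\<lambda>a b. scale (g b * f c) a) a) x"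
    unfolding contract_right_def by (simp add: mult.commute flip: sweedler_fun_scale)
  also have "\<dots> = sweedler scale (\<lambda>a b. sweedler scale (\<lambda>b c. scale (g b * f c) a) b) x"
    by (rule sweedler_coassoc[OF vector_space_scale \<tau>])
  also have "\<dots> = contract_right (\<lambda>b. g (contract_right f b)) x"
    unfolding functional_contract_right[OF g] 
    by (simp add: linear_sweedler[OF \<phi>] contract_right_def)
  finally show ?thesis .
qed

lemma contract_left_comp:
  assumes f: "functional f" and g: "functional g"
  shows "contract_left g (contract_left f x) = contract_left (\<lambda>b. g (contract_left f b)) x"
proof -
  have \<tau>: "trilinear_map scale scale (\<lambda>a b c. scale (f a * g b) c)"
    using f g by (auto simp: linear_simps)
  have \<phi>: "Vector_Spaces.linear (*) scale (\<lambda>c. scale c a)" for a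
    by (simp add: linear_simps)
  have "contract_left g (contract_left f x) =
      sweedler scale (\<lambda>a c. scale (f a) (contract_left g c)) x"
    unfolding contract_left_def[of f] using linear_contract(2)[OF g]
    by (subst linear_sweedler[OF linear_contract(2)[OF g]]) (simp add: Vector_Spaces.linear_iff)
  also have "\<dots> = sweedler scale (\<lambda>a c. sweedler scale (\<lambda>b c. scale (f a * g b) c) c) x"
    unfolding contract_left_def by (simp add: mult.commute flip: sweedler_fun_scale)
  also have "\<dots> = sweedler scale (\<lambda>a c. sweedler scale (\<lambda>a b. scale (f a * g b) c) a) x"
    by (rule sweedler_coassoc[OF vector_space_scale \<tau>, symmetric])
  also have "\<dots> = contract_left (\<lambda>b. g (contract_left f b)) x"
    unfolding functional_contract_left[OF g] 
    by (simp add: linear_sweedler[OF \<phi>] contract_left_def)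
  finally show ?thesis .
qed

lemma functional_representation:
  assumes "independent B" "span B = UNIV"
  shows "functional (\<lambda>v. representation B v b)"
  using linear_representation[OF assms] .

text \<open>
  A finite set of basis vectors that suffices to expand all second tensor factors of the chosen
  representative of \<open>\<Delta> x\<close>.
\<close>

definition comult_support :: "'h set \<Rightarrow> 'h \<Rightarrow> 'h set"
  where "comult_support B x =
    (\<Union>(a, b)\<in>Poly_Mapping.keys (comult_rep x). {c. representation B b c \<noteq> 0})"

lemma finite_comult_support [simp]: "finite (comult_support B x)"
  unfolding comult_support_def by (auto simp: finite_representation)

text \<open>
  Expanding the second tensor factors in the basis \<open>B\<close> gives \<open>\<Delta> x = \<Sum> x\<^sub>b \<otimes> b\<close>, and the coefficient
  \<open>x\<^sub>b\<close> is the contraction of \<open>x\<close> with the coordinate functional of \<open>b\<close>.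
\<close>

lemma sweedler_basis_expansion:
  assumes t: "vector_space t" and \<beta>: "bilinear_map scale t \<beta>"
    and B: "independent B" "span B = UNIV"
    and A': "finite A'" "comult_support B x \<subseteq> A'"
  shows "sweedler t \<beta> x = (\<Sum>b\<in>A'. \<beta> (contract_right (\<lambda>v. representation B v b) x) b)"
proof -
  interpret t: vector_space t by fact
  let ?r = "representation B"
    have *: "\<beta> a b = (\<Sum>c\<in>A'. t (?r b c) (\<beta> a c))"
      if "(a, b) \<in> Poly_Mapping.keys (comult_rep x)" for a b
    proof -
      interpret l: Vector_Spaces.linear scale t "\<beta> a"
        using \<beta> by (simp add: bilinear_map_def)
      have "{c. ?r b c \<noteq> 0} \<subseteq> A'" using A' that by (auto simp: comult_support_def)
      then have "(\<Sum>c\<in>A'. scale (?r b c) c) = (\<Sum>c | ?r b c \<noteq> 0. scale (?r b c) c)"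
        using A' by (intro sum.mono_neutral_right) auto
      then have "b = (\<Sum>c\<in>A'. scale (?r b c) c)"
        using sum_nonzero_representation_eq[OF B(1), of b] B(2) by simp
      then have "\<beta> a b = \<beta> a (\<Sum>c\<in>A'. scale (?r b c) c)" by simp
      then show ?thesis by (simp add: l.sum l.scale)
    qed
    have "sweedler t \<beta> x = sweedler t (\<lambda>a b. \<Sum>c\<in>A'. t (?r b c) (\<beta> a c)) x"
      unfolding sweedler_def lin_ext_def using * by (intro sum.cong) auto
    also have "\<dots> = (\<Sum>c\<in>A'. sweedler t (\<lambda>a b. t (?r b c) (\<beta> a c)) x)"
      by (rule sweedler_fun_sum[OF t])
    also have "\<dots> = (\<Sum>c\<in>A'. \<beta> (contract_right (\<lambda>v. ?r v c) x) c)"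
    proof (rule sum.cong)
      fix c
      have l: "Vector_Spaces.linear scale t (\<lambda>a. \<beta> a c)"
        using \<beta> by (simp add: bilinear_map_def)
      then show "sweedler t (\<lambda>a b. t (?r b c) (\<beta> a c)) x =
          \<beta> (contract_right (\<lambda>v. ?r v c) x) c"
        unfolding contract_right_def linear_sweedler[OF l] by (simp add: Vector_Spaces.linear_iff)
    qed simp
    finally show "sweedler t \<beta> x = (\<Sum>c\<in>A'. \<beta> (contract_right (\<lambda>v. ?r v c) x) c)" .
qed

lemma bilinear_pure_functional:
  assumes \<phi>: "Vector_Spaces.linear fscale (*) \<phi>"
    and 0: "\<And>u. u \<in> module.span fscale (bilinear_relations scale) \<Longrightarrow> \<phi> u = 0"
  shows "bilinear_map scale (*) (\<lambda>a b. \<phi> (pure (a, b)))"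
proof -
  interpret F: vector_space "fscale :: 'k \<Rightarrow> ('h \<times> 'h \<Rightarrow>\<^sub>0 'k) \<Rightarrow> _" by simp
  interpret \<phi>: Vector_Spaces.linear fscale "(*)" \<phi> by fact
  have 1: "\<phi> u = 0" if "u \<in> bilinear_relations scale" for u
    using 0 F.span_base[OF that] by simp
  show ?thesis
    using 1[OF bilinear_relations.intros(1)] 1[OF bilinear_relations.intros(2)]
      1[OF bilinear_relations.intros(3)] 1[OF bilinear_relations.intros(4)]
    by (simp add: bilinear_map_def Vector_Spaces.linear_iff \<phi>.diff \<phi>.add \<phi>.scale algebra_simps)
qed

text \<open>
  Scalar-valued bilinear maps separate the elements of \<open>H \<otimes> H\<close>, because a functional that vanishes
  on all bilinearity relations is the same thing as a bilinear map.
\<close>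

lemma comult_memI:
  assumes "\<And>\<beta>. bilinear_map scale (*) \<beta> \<Longrightarrow> sweedler (*) \<beta> x = lin_ext (*) (\<lambda>(a, b). \<beta> a b) q"
  shows "q \<in> \<Delta> x"
proof (rule comult_eqI[OF comult_rep_in], rule ccontr)
  interpret F: vector_space "fscale :: 'k \<Rightarrow> ('h \<times> 'h \<Rightarrow>\<^sub>0 'k) \<Rightarrow> _" by simp
  interpret K: vector_space "(*) :: 'k \<Rightarrow> 'k \<Rightarrow> 'k" by simp
  let ?p = "comult_rep x"
  assume "?p - q \<notin> F.span (bilinear_relations scale)"
  then obtain \<phi> where \<phi>: "Vector_Spaces.linear fscale (*) \<phi>" "\<phi> (?p - q) = 1"
      and 0: "\<And>u. u \<in> F.span (bilinear_relations scale) \<Longrightarrow> \<phi> u = 0"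
    using F.separating_functional[OF F.subspace_span] by metis
  interpret \<phi>: Vector_Spaces.linear fscale "(*)" \<phi> by fact
  have *: "lin_ext (*) (\<lambda>(a, b). \<phi> (pure (a, b))) p = \<phi> p" for p
    using linear_free_eq[OF \<phi>(1), of p] by (simp add: split_def)
  have "\<phi> ?p = \<phi> q"
    using assms[OF bilinear_pure_functional[OF \<phi>(1) 0]] unfolding sweedler_def * by simp
  then show False using \<phi>(2) by (simp add: \<phi>.diff)
qed

text \<open>
  A subspace \<open>M\<close> is a right coideal, \<open>\<Delta>(M) \<subseteq> M \<otimes> H\<close>, if and only if it is stable under
  \<open>contract_right\<close>; this is used as the definition, to keep tensors out of the arguments.
\<close>

definition right_coideal :: "'h set \<Rightarrow> bool"
  where "right_coideal M \<longleftrightarrow> subspace M \<and> (\<forall>g. functional g \<longrightarrow> contract_right g ` M \<subseteq> M)"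

definition left_coideal :: "'h set \<Rightarrow> bool"
  where "left_coideal M \<longleftrightarrow> subspace M \<and> (\<forall>g. functional g \<longrightarrow> contract_left g ` M \<subseteq> M)"

lemma right_coidealD:
  "right_coideal M \<Longrightarrow> functional g \<Longrightarrow> x \<in> M \<Longrightarrow> contract_right g x \<in> M"
  by (auto simp: right_coideal_def)

lemma left_coidealD:
  "left_coideal M \<Longrightarrow> functional g \<Longrightarrow> x \<in> M \<Longrightarrow> contract_left g x \<in> M"
  by (auto simp: left_coideal_def)

text \<open>
  The content is that a subspace \<open>D\<close> stable on both sides satisfies \<open>\<Delta>(D) \<subseteq> D \<otimes> D\<close>.  In a basis of \<open>H\<close>
  that extends a basis of \<open>D\<close>, the coefficient of \<open>b \<otimes> b'\<close> in \<open>\<Delta> x\<close> is a coordinate of a right and of a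
  left contraction of \<open>x\<close>.  Both lie in \<open>D\<close>, so the coefficient vanishes unless \<open>b, b' \<in> D\<close>.
\<close>

lemma subcoalgebra_iff_coideal:
  "subcoalgebra scale \<Delta> D \<longleftrightarrow> right_coideal D \<and> left_coideal D"
proof
  assume D: "subcoalgebra scale \<Delta> D"
  have sub: "subspace D" using D by (simp add: subcoalgebra_def)
  have "contract_right g x \<in> D \<and> contract_left g x \<in> D" if "functional g" "x \<in> D" for g x
  proof -
    obtain p where p: "p \<in> \<Delta> x" "Poly_Mapping.keys p \<subseteq> D \<times> D"
      using D \<open>x \<in> D\<close> by (auto simp: subcoalgebra_def)
    show ?thesis
      unfolding contract_right_def contract_left_def
        sweedler_eq[OF vector_space_scale bilinear_contract(1)[OF \<open>functional g\<close>] p(1)]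
        sweedler_eq[OF vector_space_scale bilinear_contract(2)[OF \<open>functional g\<close>] p(1)]
      using sub p(2) by (auto intro!: lin_ext_in_subspace subspace_scale)
  qed
  then show "right_coideal D \<and> left_coideal D"
    using sub by (auto simp: right_coideal_def left_coideal_def)
next
  interpret K: vector_space "(*) :: 'k \<Rightarrow> 'k \<Rightarrow> 'k" by simp
  assume D: "right_coideal D \<and> left_coideal D"
  then have sub: "subspace D" by (simp add: right_coideal_def)
  obtain C where C: "C \<subseteq> D" "independent C" "span C = D"
    using subspace_eq_span_basis[OF sub] .
  define B where "B = extend_basis C"
  have B: "independent B" "span B = UNIV" "C \<subseteq> B"
    using independent_extend_basis[OF C(2)] span_extend_basis[OF C(2)] extend_basis_superset[OF C(2)]
    by (auto simp: B_def)
  let ?r = "\<lambda>b v. representation B v b"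
  have r: "functional (?r b)" for b by (rule functional_representation[OF B(1,2)])
  have supp: "b \<in> D" if "?r b v \<noteq> 0" "v \<in> D" for b v
    using that representation_extend[OF B(1), of v C] B(3) C representation_ne_zero[of C v b] by auto
  have "\<exists>p\<in>\<Delta> x. Poly_Mapping.keys p \<subseteq> D \<times> D" if x: "x \<in> D" for x
  proof -
    define A where "A = comult_support B x"
    define c where "c b b' = ?r b (contract_right (?r b') x)" for b b'
    have "c b b' = ?r b' (contract_left (?r b) x)" for b b'
      unfolding c_def by (rule functional_contract_swap[OF r r])
    then have c_supp: "b \<in> D \<and> b' \<in> D" if "c b b' \<noteq> 0" for b b'
      using that supp x right_coidealD[of D "?r b'" x] left_coidealD[of D "?r b" x] D r
      by (metis c_def)
    define q where "q = (\<Sum>b'\<in>A. \<Sum>b | c b b' \<noteq> 0. Poly_Mapping.single (b, b') (c b b'))"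
    have "q \<in> \<Delta> x"
    proof (rule comult_memI)
      fix \<beta> assume \<beta>: "bilinear_map scale ((*) :: 'k \<Rightarrow> 'k \<Rightarrow> 'k) \<beta>"
      interpret L: Vector_Spaces.linear fscale "(*)" "lin_ext (*) (\<lambda>(a, b). \<beta> a b)" by simp
      have "sweedler (*) \<beta> x = (\<Sum>b'\<in>A. \<beta> (contract_right (?r b') x) b')"
        unfolding A_def by (rule sweedler_basis_expansion[OF vector_space_mult \<beta> B(1,2)]) auto
      also have "\<dots> = (\<Sum>b'\<in>A. \<Sum>b | c b b' \<noteq> 0. c b b' * \<beta> b b')"
      proof (rule sum.cong)
        fix b'
        interpret l: Vector_Spaces.linear scale "(*)" "\<lambda>a. \<beta> a b'"
          using \<beta> by (simp add: bilinear_map_def)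
        have "\<beta> (contract_right (?r b') x) b' = \<beta> (\<Sum>b | c b b' \<noteq> 0. scale (c b b') b) b'"
          using sum_nonzero_representation_eq[OF B(1), of "contract_right (?r b') x"] B(2)
          by (simp add: c_def)
        then show "\<beta> (contract_right (?r b') x) b' = (\<Sum>b | c b b' \<noteq> 0. c b b' * \<beta> b b')"
          by (simp add: l.sum l.scale)
      qed simp
      also have "\<dots> = lin_ext (*) (\<lambda>(a, b). \<beta> a b) q"
        by (simp add: q_def L.sum)
      finally show "sweedler (*) \<beta> x = lin_ext (*) (\<lambda>(a, b). \<beta> a b) q" .
    qed
    moreover have "Poly_Mapping.keys q \<subseteq> D \<times> D"
    proof
      fix k assume "k \<in> Poly_Mapping.keys q"
      then have "Poly_Mapping.lookup q k \<noteq> 0" by (simp add: in_keys_iff)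
      then obtain b b' where "Poly_Mapping.lookup (Poly_Mapping.single (b, b') (c b b')) k \<noteq> 0"
        unfolding q_def lookup_sum by (meson sum.neutral)
      then show "k \<in> D \<times> D"
        using c_supp by (auto simp: lookup_single when_def split: if_splits)
    qed
    ultimately show ?thesis by blast
  qed
  then show "subcoalgebra scale \<Delta> D" using sub by (simp add: subcoalgebra_def)
qed

end

section \<open>Conilpotency of connected bialgebras\<close>

context coalgebra
begin

lemma right_coideal_zero: "right_coideal {0}"
  using linear_map_zero[OF linear_contract(1)] by (auto simp: right_coideal_def subspace_single_0)

lemma right_coideal_sum:
  assumes "right_coideal M" "right_coideal N"
  shows "right_coideal {x + y | x y. x \<in> M \<and> y \<in> N}"
  unfolding right_coideal_def
proof (intro conjI allI impI)
  show "subspace {x + y | x y. x \<in> M \<and> y \<in> N}"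
    using assms by (intro subspace_sums) (auto simp: right_coideal_def)
  fix g assume g: "functional g"
  interpret l: Vector_Spaces.linear scale scale "contract_right g" by (rule linear_contract(1)[OF g])
  show "contract_right g ` {x + y | x y. x \<in> M \<and> y \<in> N} \<subseteq> {x + y | x y. x \<in> M \<and> y \<in> N}"
  proof safe
    fix x y assume "x \<in> M" "y \<in> N"
    then show "\<exists>x' y'. contract_right g (x + y) = x' + y' \<and> x' \<in> M \<and> y' \<in> N"
      using right_coidealD[OF assms(1) g] right_coidealD[OF assms(2) g] l.add by blast
  qed
qed

text \<open>
  The right coideal generated by \<open>x\<close>: it contains \<open>x\<close> as the contraction with the counit.
\<close>

definition right_coideal_of :: "'h \<Rightarrow> 'h set"
  where "right_coideal_of x = {contract_right g x | g. functional g}"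

lemma right_coideal_of_self: "x \<in> right_coideal_of x"
  unfolding right_coideal_of_def using functional_counit contract_counit(1)[of x, symmetric] by blast

text \<open>
  Finiteness of coalgebras: one representative of \<open>\<Delta> x\<close> involves only finitely many first factors.
\<close>

lemma right_coideal_of_finite_dim:
  "right_coideal_of x \<subseteq> span (fst ` Poly_Mapping.keys (comult_rep x))"
  by (force simp: right_coideal_of_def contract_right_def sweedler_def
        intro!: lin_ext_in_subspace span_scale intro: span_base)

lemma right_coideal_of: "right_coideal (right_coideal_of x)"
proof -
  have 0: "functional (\<lambda>_. 0)" by (simp add: Vector_Spaces.linear_iff)
  have add: "contract_right g x + contract_right h x = contract_right (\<lambda>b. g b + h b) x" for g h
    unfolding contract_right_def
    by (simp add: scale_left_distrib sweedler_fun_add)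
  have scl: "scale c (contract_right g x) = contract_right (\<lambda>b. c * g b) x" for c g
    unfolding contract_right_def by (simp flip: sweedler_fun_scale)
  have "subspace (right_coideal_of x)"
    unfolding subspace_def right_coideal_of_def
  proof (safe, goal_cases)
    case 1
    have "0 = contract_right (\<lambda>_. 0) x"
      using scl[of 0 \<epsilon>] by simp
    then show ?case using 0 by blast
  next
    case (2 _ _ g h)
    then have "functional (\<lambda>b. g b + h b)" by (simp add: Vector_Spaces.linear_iff algebra_simps)
    then show ?case using add by blast
  next
    case (3 c _ g)
    then have "functional (\<lambda>b. c * g b)" by (simp add: Vector_Spaces.linear_iff algebra_simps)
    then show ?case using scl by blast
  qed
  moreover have "contract_right g y \<in> right_coideal_of x"
    if "functional g" "y \<in> right_coideal_of x" for g y
    using that contract_right_comp functional_comp_contract(1) unfolding right_coideal_of_def by blast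
  ultimately show ?thesis by (auto simp: right_coideal_def)
qed

lemma finite_dim_contract_left:
  assumes "M \<subseteq> span T" "finite T"
  obtains T' where "finite T'" "\<And>h x. functional h \<Longrightarrow> x \<in> M \<Longrightarrow> contract_left h x \<in> span T'"
proof
  let ?T' = "\<Union>t\<in>T. snd ` Poly_Mapping.keys (comult_rep t)"
  show "finite ?T'" using assms by simp
  fix h x assume h: "functional h" and "x \<in> M"
  interpret l: Vector_Spaces.linear scale scale "contract_left h" by (rule linear_contract[OF h])
  have "contract_left h t \<in> span ?T'" if "t \<in> T" for t
    unfolding contract_left_def sweedler_def using that
    by (force intro!: lin_ext_in_subspace span_scale intro: span_base)
  then have "T \<subseteq> {y. contract_left h y \<in> span ?T'}" by auto
  moreover have "subspace {y. contract_left h y \<in> span ?T'}"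
    by (auto simp: subspace_def l.add l.scale span_add span_scale span_zero)
  ultimately show "contract_left h x \<in> span ?T'"
    using assms(1) \<open>x \<in> M\<close> span_minimal by blast
qed

end

context bialgebra
begin

lemma one_neq_zero: "(1 :: 'h) \<noteq> 0"
proof
  assume "(1 :: 'h) = 0"
  then have "\<epsilon> 1 = \<epsilon> (scale 0 1)" by simp
  then show False using counit_one linear_map_zero[OF functional_counit] by simp
qed

lemma contract_one:
  assumes "functional g"
  shows "contract_right g 1 = scale (g 1) 1" "contract_left g 1 = scale (g 1) 1"
  using assms by (simp_all add: contract_right_def contract_left_def sweedler_one)

lemma simple_span_one: "simple_subcoalgebra scale \<Delta> (span {1})"
proof -
  have "contract_right g x \<in> span {1} \<and> contract_left g x \<in> span {1}"
    if g: "functional g" and x: "x \<in> span {1}" for g x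
  proof -
    obtain c where "x = scale c 1" using x span_breakdown_eq[of x 1 "{}"] by auto
    then show ?thesis
      using linear_contract[OF g] contract_one[OF g]
      by (simp add: Vector_Spaces.linear_iff span_scale span_base del: scale_scale)
  qed
  then have "subcoalgebra scale \<Delta> (span {1})"
    by (auto simp: subcoalgebra_iff_coideal right_coideal_def left_coideal_def)
  moreover have "span {1} \<noteq> {0}" using one_neq_zero span_base[of 1 "{1}"] by auto
  moreover have "D = {0} \<or> D = span {1}"
    if D: "subcoalgebra scale \<Delta> D" "D \<subseteq> span {1}" for D
  proof (cases "D \<subseteq> {0}")
    case True
    then show ?thesis using D subspace_0 by (auto simp: subcoalgebra_def)
  next
    case False
    then obtain d where d: "d \<in> D" "d \<noteq> 0" by auto
    then obtain c where c: "d = scale c 1" using D span_breakdown_eq[of d 1 "{}"] by auto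
    have "scale (1 / c) d = 1" using c d by (cases "c = 0") auto
    then have "1 \<in> D" using D d by (metis subcoalgebra_def subspace_scale)
    then show ?thesis using D by (metis subcoalgebra_def empty_subsetI insert_subset span_minimal
          subset_antisym)
  qed
  ultimately show ?thesis by (simp add: simple_subcoalgebra_def)
qed

text \<open>
  The line through \<open>1\<close> is a simple subcoalgebra, so it is the whole coradical.
\<close>

lemma one_in_simple_subcoalgebra:
  assumes conn: "connected_coalgebra scale \<Delta>" and D: "simple_subcoalgebra scale \<Delta> D"
  shows "1 \<in> D"
proof -
  let ?R = "coradical scale \<Delta>"
  have sub: "D \<subseteq> ?R" and one: "1 \<in> ?R"
    using D simple_span_one span_base[of 1 "{1}"]
    unfolding coradical_def by (auto intro!: span_base)
  obtain B where B: "B \<subseteq> ?R" "independent B" "?R \<subseteq> span B" "card B = dim ?R"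
    using basis_exists by blast
  then obtain v where v: "B = {v}"
    using conn by (auto simp: connected_coalgebra_def card_1_singleton_iff)
  have subD: "subspace D" "D \<noteq> {0}"
    using D by (auto simp: simple_subcoalgebra_def subcoalgebra_def)
  then obtain d where d: "d \<in> D" "d \<noteq> 0" using subspace_0 by blast
  obtain c where c: "d = scale c v"
    using d sub B(3) v span_breakdown_eq[of d v "{}"] by auto
  obtain c' where c': "1 = scale c' v"
    using one B(3) v span_breakdown_eq[of 1 v "{}"] by auto
  have "scale (c' / c) d = 1" using c c' d by (cases "c = 0") auto
  then show ?thesis using subspace_scale[OF subD(1) d(1)] by metis
qed

text \<open>
  A nonzero subcoalgebra of minimal dimension inside \<open>D\<close> is simple.
\<close>

lemma one_in_bicoideal:
  assumes conn: "connected_coalgebra scale \<Delta>"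
    and D: "right_coideal D" "left_coideal D" "D \<noteq> {0}" "D \<subseteq> span T" "finite T"
  shows "1 \<in> D"
proof -
  define P where "P E \<longleftrightarrow> right_coideal E \<and> left_coideal E \<and> E \<noteq> {0} \<and> E \<subseteq> D" for E
  obtain E where E: "P E" "\<And>E'. P E' \<Longrightarrow> dim E \<le> dim E'"
    using D ex_has_least_nat[of P D dim] by (auto simp: P_def)
  have "E' = {0} \<or> E' = E" if "subcoalgebra scale \<Delta> E'" "E' \<subseteq> E" for E'
  proof (rule ccontr)
    assume *: "\<not> (E' = {0} \<or> E' = E)"
    then have "P E'" using that E(1) by (auto simp: P_def subcoalgebra_iff_coideal)
    moreover have "dim E' < dim E"
      using * that E(1) D by (intro dim_subspace_strict_mono[where T = T])
        (auto simp: P_def right_coideal_def subcoalgebra_def)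
    ultimately show False using E(2) by fastforce
  qed
  then have "simple_subcoalgebra scale \<Delta> E"
    using E(1) by (auto simp: simple_subcoalgebra_def P_def subcoalgebra_iff_coideal)
  then show ?thesis
    using one_in_simple_subcoalgebra[OF conn] E(1) by (auto simp: P_def)
qed

text \<open>
  The heart of conilpotency: if \<open>N\<close> is a maximal proper right subcoideal of a finite-dimensional right
  coideal \<open>M\<close>, then \<open>M / N\<close> is the trivial comodule.  For functionals \<open>h\<close> that vanish on \<open>N\<close>, the
  contractions \<open>contract_left h x\<close> with \<open>x \<in> M\<close> span the coefficient coalgebra of \<open>M / N\<close>.  It is a
  nonzero finite-dimensional subcoalgebra, so it contains \<open>1\<close>.  A shortest expression of \<open>1\<close> as a
  sum of such contractions is then shown to involve only vectors that the augmentation ideal of the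
  dual algebra moves into \<open>N\<close>.  One such vector outside \<open>N\<close> generates \<open>M\<close> modulo \<open>N\<close>.
\<close>

lemma augmentation_kills_maximal_quotient:
  assumes conn: "connected_coalgebra scale \<Delta>"
    and M: "right_coideal M" "M \<subseteq> span T" "finite T"
    and N: "right_coideal N" "N \<subseteq> M" "N \<noteq> M"
    and max: "\<And>N'. right_coideal N' \<Longrightarrow> N \<subseteq> N' \<Longrightarrow> N' \<subseteq> M \<Longrightarrow> N' = N \<or> N' = M"
    and g: "functional g" "g 1 = 0" and y: "y \<in> M"
  shows "contract_right g y \<in> N"
proof -
  have subM: "subspace M" and subN: "subspace N" using M N by (auto simp: right_coideal_def)
  define van where "van h \<longleftrightarrow> functional h \<and> (\<forall>n\<in>N. h n = 0)" for h
  have van_f: "functional h" if "van h" for h using that by (simp add: van_def)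
  have van_N: "contract_left h n = 0" if h: "van h" and n: "n \<in> N" for h n
  proof (rule ccontr)
    assume ne: "contract_left h n \<noteq> 0"
    obtain f where f: "functional f" "f (contract_left h n) = 1"
      using separating_functional[OF subspace_single_0, of "contract_left h n"] ne by auto
    have "f (contract_left h n) = h (contract_right f n)"
      using functional_contract_swap f van_f[OF h] by metis
    also have "\<dots> = 0" using h right_coidealD[OF N(1) f(1) n] by (simp add: van_def)
    finally show False using f by simp
  qed
  \<comment> \<open>\<open>S\<close> spans the coefficient coalgebra of \<open>M / N\<close>.\<close>
  define S where "S = {contract_left h x | h x. van h \<and> x \<in> M}"
  obtain T' where T': "finite T'" "\<And>h x. functional h \<Longrightarrow> x \<in> M \<Longrightarrow> contract_left h x \<in> span T'"
    using finite_dim_contract_left[OF M(2,3)] by blast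
  have S_right: "contract_right f s \<in> S" if "functional f" "s \<in> S" for f s
    using that contract_commute right_coidealD[OF M(1)] van_f unfolding S_def by blast
  have S_left: "contract_left f s \<in> S" if f: "functional f" and s: "s \<in> S" for f s
  proof -
    obtain h x where hx: "s = contract_left h x" "van h" "x \<in> M" using s by (auto simp: S_def)
    have "f (contract_left h n) = h (contract_right f n)" for n
      using functional_contract_swap f van_f[OF hx(2)] by metis
    then have "van (\<lambda>n. f (contract_left h n))"
      using hx(2) right_coidealD[OF N(1) f] functional_comp_contract(2)[OF f van_f[OF hx(2)]]
      by (auto simp: van_def)
    then show ?thesis
      using hx contract_left_comp[OF van_f[OF hx(2)] f] unfolding S_def by auto
  qed
  have closed: "F ` span S \<subseteq> span S"
    if F: "Vector_Spaces.linear scale scale F" and FS: "\<And>s. s \<in> S \<Longrightarrow> F s \<in> S" for F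
  proof -
    interpret F: Vector_Spaces.linear scale scale F by fact
    show ?thesis using F.span_image FS by (metis image_subsetI span_mono)
  qed
  have rc: "right_coideal (span S)"
    using closed linear_contract(1) S_right by (simp add: right_coideal_def)
  have lc: "left_coideal (span S)"
    using closed linear_contract(2) S_left by (simp add: left_coideal_def)
  have "span S \<noteq> {0}"
  proof -
    obtain x where x: "x \<in> M" "x \<notin> N" using N by auto
    obtain h where h: "functional h" "\<And>n. n \<in> N \<Longrightarrow> h n = 0" "h x = 1"
      using separating_functional[OF subN x(2)] by metis
    have "contract_left h x \<in> S" using h x by (auto simp: S_def van_def)
    moreover have "\<epsilon> (contract_left h x) = 1"
      using functional_contract_swap[OF h(1) functional_counit] h by simp
    moreover have "\<epsilon> 0 = 0" by (rule linear_map_zero[OF functional_counit])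
    ultimately show ?thesis by (metis span_base singletonD zero_neq_one)
  qed
  moreover have "span S \<subseteq> span T'" using T'(2) van_f by (intro span_minimal) (auto simp: S_def)
  ultimately have "1 \<in> span S"
    using one_in_bicoideal[OF conn rc lc] T' by metis
  \<comment> \<open>\<open>P n\<close>: the unit is a sum of \<open>n\<close> elements of \<open>S\<close>; scalars are absorbed into \<open>x\<close>.\<close>
  define P where "P n \<longleftrightarrow> (\<exists>A h x. finite (A :: 'h set) \<and> card A = n \<and>
      (\<forall>a\<in>A. van (h a) \<and> x a \<in> M) \<and> 1 = (\<Sum>a\<in>A. contract_left (h a) (x a)))" for n
  have "\<exists>n. P n"
  proof -
    obtain A r where A: "finite A" "A \<subseteq> S" "1 = (\<Sum>a\<in>A. scale (r a) a)"
      using \<open>1 \<in> span S\<close> unfolding span_explicit by blast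
    have "\<forall>a\<in>A. \<exists>h x. scale (r a) a = contract_left h x \<and> van h \<and> x \<in> M"
    proof
      fix a assume "a \<in> A"
      then obtain h x where hx: "a = contract_left h x" "van h" "x \<in> M" using A by (auto simp: S_def)
      then have "scale (r a) a = contract_left h (scale (r a) x)"
        using linear_contract(2)[OF van_f] by (simp add: Vector_Spaces.linear_iff)
      then show "\<exists>h x. scale (r a) a = contract_left h x \<and> van h \<and> x \<in> M"
        using hx subspace_scale[OF subM] by blast
    qed
    then obtain h x where hx: "\<And>a. a \<in> A \<Longrightarrow> scale (r a) a = contract_left (h a) (x a)"
        "\<And>a. a \<in> A \<Longrightarrow> van (h a) \<and> x a \<in> M"
      by metis
    have "1 = (\<Sum>a\<in>A. contract_left (h a) (x a))"
      unfolding A(3) using hx(1) by (intro sum.cong) auto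
    then have "P (card A)"
      unfolding P_def using A hx(2) by blast
    then show ?thesis ..
  qed
  then obtain n where n: "P n" "\<And>m. m < n \<Longrightarrow> \<not> P m"
    by (metis exists_least_iff)
  then obtain A h x where A: "finite (A :: 'h set)" "card A = n"
      and hx: "\<And>a. a \<in> A \<Longrightarrow> van (h a)" "\<And>a. a \<in> A \<Longrightarrow> x a \<in> M"
      and one: "1 = (\<Sum>a\<in>A. contract_left (h a) (x a))"
    unfolding P_def by blast
  have lin: "Vector_Spaces.linear scale scale (contract_left (h a))" if "a \<in> A" for a
    using linear_contract(2) van_f hx(1) that by blast
  have minimal: False
    if "j \<in> A" "\<And>a. a \<in> A - {j} \<Longrightarrow> x' a \<in> M" "1 = (\<Sum>a\<in>A - {j}. contract_left (h a) (x' a))" for j x'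
  proof -
    have "P (card (A - {j}))" unfolding P_def using that hx(1) A(1)
      by (intro exI[of _ "A - {j}"] exI[of _ h] exI[of _ x']) auto
    moreover have "card (A - {j}) < n" using A that(1) by (metis card_Diff1_less)
    ultimately show False using n(2) by blast
  qed
  have "A \<noteq> {}" using one one_neq_zero by auto
  then obtain j where j: "j \<in> A" by auto
  have split: "(\<Sum>a\<in>A. u a) = u j + (\<Sum>a\<in>A - {j}. u a)" for u :: "'h \<Rightarrow> 'h"
    using A(1) j by (rule sum.remove)
  have xj: "x j \<notin> N"
  proof
    assume "x j \<in> N"
    then have "1 = (\<Sum>a\<in>A - {j}. contract_left (h a) (x a))"
      using one split van_N hx(1) j by simp
    then show False using minimal[OF j] hx(2) by blast
  qed
  \<comment> \<open>Otherwise \<open>contract_right f (x j)\<close> generates \<open>M\<close> modulo \<open>N\<close>, so that \<open>x j\<close> agrees modulo \<open>N\<close> with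
      \<open>F (x j)\<close> for an operator \<open>F\<close> that kills \<open>1\<close> and commutes with all \<open>contract_left (h i)\<close>.
      Subtracting \<open>F 1 = 0\<close> from the expression of \<open>1\<close> cancels the term \<open>j\<close>.\<close>
  have step: "contract_right f (x j) \<in> N" if f: "functional f" "f 1 = 0" for f
  proof (rule ccontr)
    let ?z = "contract_right f (x j)"
    let ?N' = "{u + v | u v. u \<in> right_coideal_of ?z \<and> v \<in> N}"
    assume z: "?z \<notin> N"
    have zM: "?z \<in> M" using right_coidealD[OF M(1) f(1) hx(2)[OF j]] .
    have "right_coideal ?N'" by (rule right_coideal_sum[OF right_coideal_of N(1)])
    moreover have "N \<subseteq> ?N'"
      using subspace_0 right_coideal_of by (force simp: right_coideal_def)
    moreover have "?N' \<subseteq> M"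
      using N(2) right_coidealD[OF M(1) _ zM] subM
      by (auto simp: right_coideal_of_def intro!: subspace_add)
    moreover have "?z \<in> ?N'"
      using right_coideal_of_self subspace_0[OF subN] by (metis (mono_tags, lifting) add_0_right mem_Collect_eq)
    ultimately have "?N' = M" using max z by blast
    then obtain a v where av: "functional a" "v \<in> N" "x j = contract_right a ?z + v"
      using hx(2)[OF j] by (auto simp: right_coideal_of_def)
    define F where "F y = contract_right a (contract_right f y)" for y
    have lF: "Vector_Spaces.linear scale scale F"
      using linear_contract(1)[OF av(1)] linear_contract(1)[OF f(1)]
      by (simp add: F_def Vector_Spaces.linear_iff)
    then interpret F: Vector_Spaces.linear scale scale F .
    have FM: "F y \<in> M" if "y \<in> M" for y
      using that right_coidealD[OF M(1)] f av by (simp add: F_def)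
    have F_comm: "F (contract_left (h i) y) = contract_left (h i) (F y)" if "i \<in> A" for i y
      using that contract_commute hx(1) van_f f av by (simp add: F_def)
    have "0 = F 1"
      using linear_map_zero[OF linear_contract(1)[OF av(1)]] f by (simp add: F_def contract_one)
    also have "\<dots> = (\<Sum>i\<in>A. contract_left (h i) (F (x i)))"
      unfolding one F.sum using F_comm by (intro sum.cong) auto
    finally have 0: "contract_left (h j) (F (x j)) = - (\<Sum>i\<in>A - {j}. contract_left (h i) (F (x i)))"
      unfolding split by (simp add: eq_neg_iff_add_eq_0)
    have "contract_left (h j) (x j) = contract_left (h j) (F (x j) + v)"
      using av(3) by (simp add: F_def)
    also have "\<dots> = contract_left (h j) (F (x j))"
      using lin[OF j] van_N[OF hx(1)[OF j] av(2)] by (simp add: Vector_Spaces.linear_iff)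
    finally have "1 = (\<Sum>i\<in>A - {j}. contract_left (h i) (x i) - contract_left (h i) (F (x i)))"
      using one 0 split by (simp add: sum_subtractf)
    also have "\<dots> = (\<Sum>i\<in>A - {j}. contract_left (h i) (x i - F (x i)))"
    proof (rule sum.cong)
      fix i assume "i \<in> A - {j}"
      then interpret l: Vector_Spaces.linear scale scale "contract_left (h i)" using lin by blast
      show "contract_left (h i) (x i) - contract_left (h i) (F (x i)) = contract_left (h i) (x i - F (x i))"
        by (simp add: l.diff)
    qed simp
    finally show False using minimal[OF j, of "\<lambda>i. x i - F (x i)"] hx(2) FM subM
      by (auto intro: subspace_diff)
  qed
  \<comment> \<open>By \<open>step\<close>, the line through \<open>x j\<close> and \<open>N\<close> together form a right coideal, hence exhaust \<open>M\<close>.\<close>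
  let ?L = "{u + v | u v. u \<in> span {x j} \<and> v \<in> N}"
  have "right_coideal ?L"
    unfolding right_coideal_def
  proof (intro conjI allI impI)
    show "subspace ?L" by (intro subspace_sums subN) simp
    fix f assume f: "functional f"
    interpret l: Vector_Spaces.linear scale scale "contract_right f" by (rule linear_contract(1)[OF f])
    \<comment> \<open>The part of \<open>f\<close> in the augmentation ideal of the dual algebra.\<close>
    let ?f = "\<lambda>b. f b - f 1 * \<epsilon> b"
    have f': "functional ?f" "?f 1 = 0"
      using f functional_counit counit_one by (auto simp: Vector_Spaces.linear_iff algebra_simps)
    have "contract_right f (x j) = contract_right ?f (x j) + scale (f 1) (contract_right \<epsilon> (x j))"
      unfolding contract_right_def
      by (simp add: scale_left_distrib[symmetric] flip: sweedler_fun_scale sweedler_fun_add)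
    then have *: "contract_right f (x j) = contract_right ?f (x j) + scale (f 1) (x j)" by simp
    show "contract_right f ` ?L \<subseteq> ?L"
    proof safe
      fix u v assume u: "u \<in> span {x j}" and v: "v \<in> N"
      obtain c where c: "u = scale c (x j)" using u span_breakdown_eq[of u "x j" "{}"] by auto
      have "contract_right f (u + v) = scale (c * f 1) (x j) +
          (scale c (contract_right ?f (x j)) + contract_right f v)"
        by (simp add: c l.add l.scale * scale_right_distrib)
      moreover have "scale c (contract_right ?f (x j)) + contract_right f v \<in> N"
        using step[OF f'] right_coidealD[OF N(1) f v] subN by (auto intro: subspace_add subspace_scale)
      ultimately show "\<exists>u' v'. contract_right f (u + v) = u' + v' \<and> u' \<in> span {x j} \<and> v' \<in> N"
        by (metis span_base span_scale singletonI)
    qed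
  qed
  moreover have "N \<subseteq> ?L" using span_zero by force
  moreover have "?L \<subseteq> M"
    using N(2) span_minimal[of "{x j}" M] hx(2)[OF j] subM by (auto intro!: subspace_add)
  moreover have "x j \<in> ?L"
    using span_base[of "x j" "{x j}"] subspace_0[OF subN]
    by (metis (mono_tags, lifting) add_0_right mem_Collect_eq singletonI)
  ultimately have "?L = M" using max xj by blast
  then obtain u v where uv: "y = u + v" "u \<in> span {x j}" "v \<in> N" using y by blast
  then obtain c where c: "u = scale c (x j)" using span_breakdown_eq[of u "x j" "{}"] by auto
  have "contract_right g y = scale c (contract_right g (x j)) + contract_right g v"
    using uv c linear_contract(1)[OF g(1)] by (simp add: Vector_Spaces.linear_iff)
  then show ?thesis
    using step[OF g] right_coidealD[OF N(1) g(1) uv(3)] subN by (simp add: subspace_add subspace_scale)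
qed

text \<open>
  The vectors killed by all \<open>n\<close>-fold products from the augmentation ideal \<open>{g. g 1 = 0}\<close> of the dual
  algebra.  If the coradical is the line through \<open>1\<close>, the stage with index \<open>Suc n\<close> is the \<open>n\<close>-th term
  of the coradical filtration in the usual numbering.
\<close>

primrec conilpotent_filtration :: "nat \<Rightarrow> 'h set" where
  "conilpotent_filtration 0 = {0}"
| "conilpotent_filtration (Suc n) =
    {x. \<forall>g. functional g \<longrightarrow> g 1 = 0 \<longrightarrow> contract_right g x \<in> conilpotent_filtration n}"

lemma right_coideal_in_filtration:
  assumes conn: "connected_coalgebra scale \<Delta>"
    and M: "right_coideal M" "M \<subseteq> span T" "finite T"
  shows "\<exists>n. M \<subseteq> conilpotent_filtration n"
  using M(1,2)
proof (induction "dim M" arbitrary: M rule: less_induct)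
  case less
  show ?case
  proof (cases "M = {0}")
    case True
    then show ?thesis by (intro exI[of _ 0]) simp
  next
    case False
    define P where "P N \<longleftrightarrow> right_coideal N \<and> N \<subseteq> M \<and> N \<noteq> M" for N
    have "P {0}" using False less.prems right_coideal_zero subspace_0
      by (auto simp: P_def right_coideal_def)
    moreover have lt: "dim N < dim M" if "P N" for N
      using that less.prems M(3) by (intro dim_subspace_strict_mono[where T = T])
        (auto simp: P_def right_coideal_def)
    then have "\<forall>N. P N \<longrightarrow> dim N < dim M" by simp
    ultimately have "\<exists>N. P N \<and> (\<forall>N'. P N' \<longrightarrow> dim N' \<le> dim N)"
      by (rule ex_has_greatest_nat)
    then obtain N where N: "P N" "\<And>N'. P N' \<Longrightarrow> dim N' \<le> dim N"
      by blast
    have maxN: "N' = N \<or> N' = M" if N': "right_coideal N'" "N \<subseteq> N'" "N' \<subseteq> M" for N'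
    proof (rule ccontr)
      assume *: "\<not> (N' = N \<or> N' = M)"
      then have "P N'" using N' by (simp add: P_def)
      moreover have "dim N < dim N'"
        using * N' N(1) less.prems M(3) by (intro dim_subspace_strict_mono[where T = T])
          (auto simp: P_def right_coideal_def)
      ultimately show False using N(2) by fastforce
    qed
    have kill: "contract_right g y \<in> N" if "functional g" "g 1 = 0" "y \<in> M" for g y
      using N(1) by (intro augmentation_kills_maximal_quotient[OF conn less.prems M(3) _ _ _ maxN that])
        (auto simp: P_def)
    obtain n where "N \<subseteq> conilpotent_filtration n"
      using less.hyps[OF lt[OF N(1)]] N(1) less.prems by (auto simp: P_def)
    then have "M \<subseteq> conilpotent_filtration (Suc n)" using kill by auto
    then show ?thesis ..
  qed
qed

lemma conilpotent_filtration_exhausts: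
  assumes "connected_coalgebra scale \<Delta>"
  shows "\<exists>n. x \<in> conilpotent_filtration n"
  using right_coideal_in_filtration[OF assms right_coideal_of[of x] right_coideal_of_finite_dim]
    right_coideal_of_self[of x] by auto

text \<open>
  In a basis that contains \<open>1\<close>, every term of \<open>\<Delta> x = \<Sum> x\<^sub>b \<otimes> b\<close> with \<open>b \<noteq> 1\<close> has \<open>x\<^sub>b\<close> one step lower in
  the filtration, since the coordinate functional of \<open>b\<close> vanishes at \<open>1\<close>.
\<close>

lemma sweedler_zero_of_filtration:
  assumes t: "vector_space t" and \<beta>: "bilinear_map scale t \<beta>"
    and x: "x \<in> conilpotent_filtration (Suc n)"
    and 0: "\<And>y b. y \<in> conilpotent_filtration n \<Longrightarrow> \<beta> y b = 0" and 1: "\<And>a. \<beta> a 1 = 0"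
  shows "sweedler t \<beta> x = 0"
proof -
  have ind: "independent {1}" using one_neq_zero by simp
  let ?B = "extend_basis {1}"
  have B: "independent ?B" "span ?B = UNIV" "1 \<in> ?B"
    using independent_extend_basis[OF ind] span_extend_basis[OF ind] extend_basis_superset[OF ind]
    by auto
  have "sweedler t \<beta> x = (\<Sum>b\<in>comult_support ?B x. \<beta> (contract_right (\<lambda>v. representation ?B v b) x) b)"
    by (rule sweedler_basis_expansion[OF t \<beta> B(1,2)]) auto
  also have "\<dots> = 0"
  proof (rule sum.neutral, rule ballI)
    fix b assume "b \<in> comult_support ?B x"
    show "\<beta> (contract_right (\<lambda>v. representation ?B v b) x) b = 0"
    proof (cases "b = 1")
      case False
      then have "representation ?B 1 b = 0" using B by (simp add: representation_basis)
      then show ?thesis using x 0 functional_representation[OF B(1,2)] by simp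
    qed (simp add: 1)
  qed
  finally show ?thesis .
qed

end

section \<open>Convolution\<close>

unbundle fps_syntax

text \<open>
  The target of the convolution algebra is kept general because two are needed: \<open>H\<close> itself for the
  logarithm of the identity, and the polynomial algebra for algebraic independence.
\<close>

locale convolution = bialgebra scale \<Delta> \<epsilon> + A: unital_algebra sA
  for scale :: "'k::field_char_0 \<Rightarrow> 'h::comm_ring_1 \<Rightarrow> 'h"
    and \<Delta> :: "'h \<Rightarrow> ('h \<times> 'h \<Rightarrow>\<^sub>0 'k) set"
    and \<epsilon> :: "'h \<Rightarrow> 'k"
    and sA :: "'k \<Rightarrow> 'a::comm_ring_1 \<Rightarrow> 'a"
begin

abbreviation lin :: "('h \<Rightarrow> 'a) \<Rightarrow> bool"
  where "lin \<equiv> Vector_Spaces.linear scale sA"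

definition conv :: "('h \<Rightarrow> 'a) \<Rightarrow> ('h \<Rightarrow> 'a) \<Rightarrow> 'h \<Rightarrow> 'a"
  where "conv f g = sweedler sA (\<lambda>a b. f a * g b)"

definition conv_unit :: "'h \<Rightarrow> 'a"
  where "conv_unit x = sA (\<epsilon> x) 1"

primrec conv_pow :: "('h \<Rightarrow> 'a) \<Rightarrow> nat \<Rightarrow> 'h \<Rightarrow> 'a" where
  "conv_pow f 0 = conv_unit"
| "conv_pow f (Suc n) = conv f (conv_pow f n)"

lemma vector_space_sA [simp]: "vector_space sA"
  by (rule A.vector_space_axioms)

lemma lin_mult_left: "Vector_Spaces.linear sA sA (\<lambda>u. c * u)"
  by (simp add: Vector_Spaces.linear_iff distrib_left A.scale_mult_right)

lemma lin_mult_right: "Vector_Spaces.linear sA sA (\<lambda>u. u * c)"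
  by (simp add: Vector_Spaces.linear_iff distrib_right A.scale_mult_left)

lemma bilinear_conv: "lin f \<Longrightarrow> lin g \<Longrightarrow> bilinear_map scale sA (\<lambda>a b. f a * g b)"
  by (simp add: bilinear_map_def Vector_Spaces.linear_iff distrib_left distrib_right
      A.scale_mult_left A.scale_mult_right)

lemma lin_conv: "lin f \<Longrightarrow> lin g \<Longrightarrow> lin (conv f g)"
  unfolding conv_def by (rule sweedler_linear[OF vector_space_sA bilinear_conv])

lemma lin_conv_unit [simp]: "lin conv_unit"
  using functional_counit
  by (simp add: Vector_Spaces.linear_iff conv_unit_def A.scale_left_distrib)

lemma lin_conv_pow: "lin f \<Longrightarrow> lin (conv_pow f n)"
  by (induction n) (simp_all add: lin_conv)

lemma conv_unit_mult [simp]: "conv_unit x * y = sA (\<epsilon> x) y" "y * conv_unit x = sA (\<epsilon> x) y"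
  by (simp_all add: conv_unit_def A.scale_mult_left A.scale_mult_right)

lemma conv_unit_one [simp]: "conv_unit 1 = 1"
  by (simp add: conv_unit_def counit_one)

lemma conv_unit_left: "lin f \<Longrightarrow> conv conv_unit f = f"
  unfolding conv_def by (rule ext) (simp add: sweedler_counit_left)

lemma conv_unit_right: "lin f \<Longrightarrow> conv f conv_unit = f"
  unfolding conv_def by (rule ext) (simp add: sweedler_counit_right)

lemma conv_assoc:
  assumes "lin f" "lin g" "lin h"
  shows "conv (conv f g) h = conv f (conv g h)"
proof
  fix x
  have \<tau>: "trilinear_map scale sA (\<lambda>a b c. f a * g b * h c)"
    using assms by (simp add: trilinear_map_def Vector_Spaces.linear_iff algebra_simps
        A.scale_mult_left A.scale_mult_right)
  have "conv (conv f g) h x = sweedler sA (\<lambda>a c. sweedler sA (\<lambda>a b. f a * g b * h c) a) x"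
    unfolding conv_def by (subst linear_sweedler[OF lin_mult_right]) simp
  also have "\<dots> = sweedler sA (\<lambda>a b. sweedler sA (\<lambda>b c. f a * g b * h c) b) x"
    by (rule sweedler_coassoc[OF vector_space_sA \<tau>])
  also have "\<dots> = conv f (conv g h) x"
    unfolding conv_def by (subst linear_sweedler[OF lin_mult_left]) (simp add: mult.assoc)
  finally show "conv (conv f g) h x = conv f (conv g h) x" .
qed

lemma conv_pow_add: "lin f \<Longrightarrow> conv (conv_pow f m) (conv_pow f n) = conv_pow f (m + n)"
  by (induction m) (simp_all add: conv_unit_left lin_conv_pow conv_assoc)

lemma conv_pow_Suc_right: "lin f \<Longrightarrow> conv_pow f (Suc n) = conv (conv_pow f n) f"
  using conv_pow_add[of f n 1] by (simp add: conv_unit_right)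

lemma conv_times:
  "conv f g x * conv f' g' y = sweedler sA (\<lambda>a b. sweedler sA (\<lambda>c d. f a * f' c * (g b * g' d)) y) x"
  unfolding conv_def
  by (subst linear_sweedler[OF lin_mult_right], subst linear_sweedler[OF lin_mult_left])
    (simp add: ac_simps)

lemma conv_mult:
  assumes "lin f" "lin g"
  shows "conv f g (x * y) = sweedler sA (\<lambda>a b. sweedler sA (\<lambda>c d. f (a * c) * g (b * d)) y) x"
  unfolding conv_def by (rule sweedler_mult[OF vector_space_sA bilinear_conv[OF assms]])

text \<open>
  With \<open>g\<close> a power of \<open>f\<close>, commutativity of the target enters here: \<open>f(x\<^sub>1) f(y\<^sub>1) g(x\<^sub>2) g(y\<^sub>2)\<close> 
  has to be regrouped as \<open>f(x\<^sub>1) g(x\<^sub>2) f(y\<^sub>1) g(y\<^sub>2)\<close>.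
\<close>

lemma conv_pow_multiplicative:
  assumes f: "lin f" and mult: "\<And>x y. f (x * y) = f x * f y"
  shows "conv_pow f n (x * y) = conv_pow f n x * conv_pow f n y"
proof (induction n arbitrary: x y)
  case 0
  then show ?case by (simp add: conv_unit_def counit_mult A.scale_mult_left)
next
  case (Suc n)
  show ?case
    by (simp add: conv_mult[OF f lin_conv_pow[OF f]] conv_times mult Suc)
qed

text \<open>
  The Leibniz rule for convolution powers of an \<open>\<epsilon>\<close>-derivation, by the same induction as the binomial
  theorem.
\<close>

lemma conv_pow_derivation:
  assumes f: "lin f" and der: "\<And>x y. f (x * y) = conv_unit x * f y + f x * conv_unit y"
  shows "conv_pow f n (x * y) = (\<Sum>i\<le>n. of_nat (n choose i) * (conv_pow f i x * conv_pow f (n - i) y))"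
proof (induction n arbitrary: x y)
  case 0
  then show ?case by (simp add: conv_unit_def counit_mult A.scale_mult_left)
next
  case (Suc n)
  let ?D = "conv_pow f"
  have lc: "sweedler sA (\<lambda>a b. c * \<beta> a b) u = c * sweedler sA \<beta> u" for c \<beta> u
    using linear_sweedler[OF lin_mult_left[of c], of \<beta> u] by simp
  have "?D (Suc n) (x * y) = sweedler sA (\<lambda>a b. sweedler sA (\<lambda>c d.
      (conv_unit a * f c + f a * conv_unit c) *
      (\<Sum>i\<le>n. of_nat (n choose i) * (?D i b * ?D (n - i) d))) y) x"
    by (simp only: conv_pow.simps conv_mult[OF f lin_conv_pow[OF f]] der Suc)
  also have "\<dots> = sweedler sA (\<lambda>a b. sweedler sA (\<lambda>c d. \<Sum>i\<le>n. of_nat (n choose i) *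
      (conv_unit a * f c * (?D i b * ?D (n - i) d) + f a * conv_unit c * (?D i b * ?D (n - i) d))) y) x"
    by (simp only: sum_distrib_left distrib_right distrib_left ac_simps)
  also have "\<dots> = (\<Sum>i\<le>n. of_nat (n choose i) *
      (conv conv_unit (?D i) x * conv f (?D (n - i)) y + conv f (?D i) x * conv conv_unit (?D (n - i)) y))"
    by (simp only: conv_times sweedler_fun_sum[OF vector_space_sA] lc
        sweedler_fun_add[OF vector_space_sA])
  also have "\<dots> = (\<Sum>i\<le>n. of_nat (n choose i) * (?D i x * ?D (Suc n - i) y)) +
      (\<Sum>i\<le>n. of_nat (n choose i) * (?D (Suc i) x * ?D (n - i) y))"
    by (simp add: conv_unit_left lin_conv_pow f distrib_left sum.distrib Suc_diff_le)
  also have "(\<Sum>i\<le>n. of_nat (n choose i) * (?D i x * ?D (Suc n - i) y)) =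
      ?D 0 x * ?D (Suc n) y + (\<Sum>i\<le>n. of_nat (n choose Suc i) * (?D (Suc i) x * ?D (n - i) y))"
    using sum.atMost_Suc_shift[of "\<lambda>i. of_nat (n choose i) * (?D i x * ?D (Suc n - i) y)" n]
    by (simp add: binomial_eq_0 del: conv_pow.simps)
  finally show ?case
    by (simp add: sum.atMost_Suc_shift[of _ n] distrib_right sum.distrib add_ac del: sum.atMost_Suc
        conv_pow.simps)
qed

lemma conv_pow_zero_on_filtration:
  assumes f: "lin f" "f 1 = 0"
  shows "x \<in> conilpotent_filtration n \<Longrightarrow> n \<le> m \<Longrightarrow> conv_pow f m x = 0"
proof (induction n arbitrary: m x)
  case 0
  then show ?case using linear_map_zero[OF lin_conv_pow[OF f(1)]] by simp
next
  case (Suc n)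
  then obtain m' where m': "m = Suc m'" "n \<le> m'" by (cases m) auto
  show ?case
    unfolding m'(1) conv_pow_Suc_right[OF f(1)] conv_def
    by (rule sweedler_zero_of_filtration[OF vector_space_sA bilinear_conv Suc.prems(1)])
      (use Suc.IH m' f lin_conv_pow in auto)
qed

section \<open>Power series in a locally nilpotent map\<close>

definition locally_nilpotent :: "('h \<Rightarrow> 'a) \<Rightarrow> bool"
  where "locally_nilpotent f \<longleftrightarrow> lin f \<and> (\<forall>x. \<exists>N. \<forall>m\<ge>N. conv_pow f m x = 0)"

lemma locally_nilpotent_of_connected:
  assumes "connected_coalgebra scale \<Delta>" "lin f" "f 1 = 0"
  shows "locally_nilpotent f"
  using conilpotent_filtration_exhausts[OF assms(1)] conv_pow_zero_on_filtration[OF assms(2,3)] assms(2)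
  unfolding locally_nilpotent_def by blast

lemma locally_nilpotent_uniform:
  assumes "locally_nilpotent f" "finite X"
  obtains N where "\<And>x m. x \<in> X \<Longrightarrow> N \<le> m \<Longrightarrow> conv_pow f m x = 0"
proof -
  obtain N where N: "\<And>x m. N x \<le> m \<Longrightarrow> conv_pow f m x = 0"
    using assms(1) unfolding locally_nilpotent_def by metis
  show thesis
  proof (rule that)
    fix x m assume "x \<in> X" "Max (insert 0 (N ` X)) \<le> m"
    then show "conv_pow f m x = 0" using N assms(2) by (auto intro!: N)
  qed
qed

text \<open>
  The value \<open>F(f)\<close> of a power series at \<open>f\<close> for the convolution product.  For locally nilpotent \<open>f\<close> the
  sum is finite at each \<open>x\<close>, and \<open>F \<mapsto> F(f)\<close> is compatible with products and with composition.
\<close>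

definition fps_at :: "('h \<Rightarrow> 'a) \<Rightarrow> 'k fps \<Rightarrow> 'h \<Rightarrow> 'a"
  where "fps_at f F x = (\<Sum>n | conv_pow f n x \<noteq> 0. sA (F $ n) (conv_pow f n x))"

lemma fps_at_eq:
  assumes "\<And>m. N \<le> m \<Longrightarrow> conv_pow f m x = 0"
  shows "fps_at f F x = (\<Sum>n<N. sA (F $ n) (conv_pow f n x))"
  unfolding fps_at_def using assms by (intro sum.mono_neutral_left) (auto simp: not_less[symmetric])

lemma lin_fps_at:
  assumes "locally_nilpotent f"
  shows "lin (fps_at f F)"
proof -
  have lf: "lin f" using assms by (simp add: locally_nilpotent_def)
  have "fps_at f F (x + y) = fps_at f F x + fps_at f F y" for x y
  proof -
    obtain N where N: "\<And>z m. z \<in> {x, y, x + y} \<Longrightarrow> N \<le> m \<Longrightarrow> conv_pow f m z = 0"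
      using locally_nilpotent_uniform[OF assms, of "{x, y, x + y}"] by blast
    have "conv_pow f n (x + y) = conv_pow f n x + conv_pow f n y" for n
      using lin_conv_pow[OF lf] by (simp add: Vector_Spaces.linear_iff)
    then show ?thesis
      using N by (simp add: fps_at_eq[of N] A.scale_right_distrib sum.distrib)
  qed
  moreover have "fps_at f F (scale c x) = sA c (fps_at f F x)" for c x
  proof -
    obtain N where N: "\<And>z m. z \<in> {x, scale c x} \<Longrightarrow> N \<le> m \<Longrightarrow> conv_pow f m z = 0"
      using locally_nilpotent_uniform[OF assms, of "{x, scale c x}"] by blast
    have "conv_pow f n (scale c x) = sA c (conv_pow f n x)" for n
      using lin_conv_pow[OF lf] by (simp add: Vector_Spaces.linear_iff)
    then show ?thesis
      using N by (simp add: fps_at_eq[of N] A.scale_sum_right mult.commute)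
  qed
  ultimately show ?thesis by (simp add: Vector_Spaces.linear_iff)
qed

lemma fps_at_mult:
  assumes f: "locally_nilpotent f"
  shows "fps_at f (F * G) = conv (fps_at f F) (fps_at f G)"
proof
  fix x
  have lf: "lin f" using f by (simp add: locally_nilpotent_def)
  let ?K = "Poly_Mapping.keys (comult_rep x)"
  \<comment> \<open>One bound that serves \<open>x\<close> and all factors occurring in the representative of \<open>\<Delta> x\<close>.\<close>
  obtain N where N: "\<And>z m. z \<in> insert x (fst ` ?K \<union> snd ` ?K) \<Longrightarrow> N \<le> m \<Longrightarrow> conv_pow f m z = 0"
    using locally_nilpotent_uniform[OF f, of "insert x (fst ` ?K \<union> snd ` ?K)"] by auto
  have *: "fps_at f F a * fps_at f G b =
      (\<Sum>i<N. \<Sum>j<N. sA (F $ i * G $ j) (conv_pow f i a * conv_pow f j b))"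
    if "(a, b) \<in> ?K" for a b
  proof -
    have "fps_at f F a = (\<Sum>n<N. sA (F $ n) (conv_pow f n a))"
        "fps_at f G b = (\<Sum>n<N. sA (G $ n) (conv_pow f n b))"
      using that by (auto intro!: fps_at_eq N image_eqI[of _ _ "(a, b)"])
    then show ?thesis
      by (simp add: sum_product A.scale_mult_left A.scale_mult_right mult.commute)
  qed
  have "conv (fps_at f F) (fps_at f G) x =
      sweedler sA (\<lambda>a b. \<Sum>i<N. \<Sum>j<N. sA (F $ i * G $ j) (conv_pow f i a * conv_pow f j b)) x"
    unfolding conv_def sweedler_def lin_ext_def using * by (intro sum.cong) auto
  also have "\<dots> = (\<Sum>i<N. \<Sum>j<N. sA (F $ i * G $ j) (conv_pow f (i + j) x))"
    by (simp add: sweedler_fun_sum sweedler_fun_scale[OF vector_space_sA] conv_pow_add[OF lf, symmetric] conv_def)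
  also have "\<dots> = (\<Sum>(i, j)\<in>{..<N} \<times> {..<N}. sA (F $ i * G $ j) (conv_pow f (i + j) x))"
    by (simp add: sum.cartesian_product)
  also have "\<dots> = (\<Sum>(i, j)\<in>{(i, j). i + j < N}. sA (F $ i * G $ j) (conv_pow f (i + j) x))"
  proof (intro sum.mono_neutral_right)
    show "\<forall>u\<in>{..<N} \<times> {..<N} - {(i, j). i + j < N}.
        (case u of (i, j) \<Rightarrow> sA (F $ i * G $ j) (conv_pow f (i + j) x)) = 0"
    proof
      fix u assume "u \<in> {..<N} \<times> {..<N} - {(i, j). i + j < N}"
      then obtain i j where u: "u = (i, j)" "N \<le> i + j" by (cases u) auto
      show "(case u of (i, j) \<Rightarrow> sA (F $ i * G $ j) (conv_pow f (i + j) x)) = 0"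
        using N[of x "i + j"] u by simp
    qed
  qed auto
  also have "\<dots> = (\<Sum>n<N. \<Sum>i\<le>n. sA (F $ i * G $ (n - i)) (conv_pow f n x))"
    by (subst sum.triangle_reindex) simp
  also have "\<dots> = fps_at f (F * G) x"
    using N by (simp add: fps_at_eq[of N] fps_mult_nth A.scale_sum_left atMost_atLeast0)
  finally show "fps_at f (F * G) x = conv (fps_at f F) (fps_at f G) x" by simp
qed

lemma fps_at_one [simp]:
  assumes "locally_nilpotent f"
  shows "fps_at f 1 = conv_unit"
proof
  fix x
  obtain N where N: "\<And>m. N \<le> m \<Longrightarrow> conv_pow f m x = 0"
    using assms unfolding locally_nilpotent_def by metis
  have "fps_at f 1 x = (\<Sum>n<Suc N. sA (1 $ n) (conv_pow f n x))"
    using N by (intro fps_at_eq) auto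
  also have "\<dots> = conv_unit x"
    by (subst sum.lessThan_Suc_shift) simp
  finally show "fps_at f 1 x = conv_unit x" .
qed

lemma fps_at_one_plus_X:
  assumes "locally_nilpotent f"
  shows "fps_at f (1 + fps_X) x = conv_unit x + f x"
proof -
  have lf: "lin f" using assms by (simp add: locally_nilpotent_def)
  obtain N where N: "\<And>m. N \<le> m \<Longrightarrow> conv_pow f m x = 0"
    using assms unfolding locally_nilpotent_def by metis
  have "fps_at f (1 + fps_X) x = (\<Sum>n<Suc (Suc N). sA ((1 + fps_X) $ n) (conv_pow f n x))"
    using N by (intro fps_at_eq) auto
  also have "\<dots> = conv_unit x + f x"
    by (simp add: sum.lessThan_Suc_shift conv_unit_right[OF lf] fps_X_def del: sum.lessThan_Suc)
  finally show ?thesis .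
qed

lemma fps_at_power:
  assumes "locally_nilpotent f"
  shows "fps_at f (F ^ n) = conv_pow (fps_at f F) n"
  by (induction n) (simp_all add: assms fps_at_mult)

lemma fps_at_compose:
  assumes f: "locally_nilpotent f" and L: "L $ 0 = 0"
  shows "locally_nilpotent (fps_at f L)" "fps_at (fps_at f L) F = fps_at f (F oo L)"
proof -
  \<comment> \<open>\<open>L\<^sup>m\<close> starts in degree \<open>m\<close>, so both the inner and the outer sum can be cut at the same bound.\<close>
  have z: "(L ^ m) $ n = 0" if "n < m" for m n
    using startsby_zero_power_prefix[OF L] that by blast
  have pow: "conv_pow (fps_at f L) m x = (\<Sum>n<N. sA ((L ^ m) $ n) (conv_pow f n x))"
    if "\<And>m. N \<le> m \<Longrightarrow> conv_pow f m x = 0" for x N m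
    using that by (simp add: fps_at_power[OF f, symmetric] fps_at_eq[of N])
  have nil: "conv_pow (fps_at f L) m x = 0" if "\<And>m. N \<le> m \<Longrightarrow> conv_pow f m x = 0" "N \<le> m" for x N m
  proof -
    have "conv_pow (fps_at f L) m x = (\<Sum>n<N. sA ((L ^ m) $ n) (conv_pow f n x))"
      by (rule pow) (rule that(1))
    also have "\<dots> = 0" using that(2) z by (intro sum.neutral) auto
    finally show ?thesis .
  qed
  show "locally_nilpotent (fps_at f L)"
    using f lin_fps_at[OF f] nil unfolding locally_nilpotent_def by meson
  show "fps_at (fps_at f L) F = fps_at f (F oo L)"
  proof
    fix x
    obtain N where N: "\<And>m. N \<le> m \<Longrightarrow> conv_pow f m x = 0"
      using f unfolding locally_nilpotent_def by metis
    have "fps_at (fps_at f L) F x = (\<Sum>m<N. sA (F $ m) (\<Sum>n<N. sA ((L ^ m) $ n) (conv_pow f n x)))"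
      using nil[OF N] by (simp add: fps_at_eq[of N] pow[OF N])
    also have "\<dots> = (\<Sum>m<N. \<Sum>n<N. sA (F $ m * (L ^ m) $ n) (conv_pow f n x))"
      by (simp add: A.scale_sum_right)
    also have "\<dots> = (\<Sum>n<N. \<Sum>m<N. sA (F $ m * (L ^ m) $ n) (conv_pow f n x))"
      by (rule sum.swap)
    also have "\<dots> = (\<Sum>n<N. sA ((F oo L) $ n) (conv_pow f n x))"
    proof (rule sum.cong)
      fix n assume "n \<in> {..<N}"
      then have "(F oo L) $ n = (\<Sum>m<N. F $ m * (L ^ m) $ n)"
        unfolding fps_compose_nth using z by (intro sum.mono_neutral_left) (auto simp: not_le)
      then show "(\<Sum>m<N. sA (F $ m * (L ^ m) $ n) (conv_pow f n x)) = sA ((F oo L) $ n) (conv_pow f n x)"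
        by (simp add: A.scale_sum_left)
    qed simp
    also have "\<dots> = fps_at f (F oo L) x" using N by (simp add: fps_at_eq[of N])
    finally show "fps_at (fps_at f L) F x = fps_at f (F oo L) x" .
  qed
qed

end

lemma fps_exp_compose_ln: "fps_exp 1 oo fps_ln (1 :: 'k::field_char_0) = 1 + fps_X"
proof -
  have "fps_ln 1 = fps_inv (fps_exp (1 :: 'k) - 1)" by (rule fps_ln_fps_exp_inv) simp
  moreover have "(fps_exp (1 :: 'k) - 1) oo fps_inv (fps_exp 1 - 1) = fps_X"
    by (rule fps_inv_right) auto
  ultimately show ?thesis by (simp add: fps_compose_sub_distrib diff_eq_eq)
qed

section \<open>The logarithm of the identity\<close>

text \<open>
  Characteristic 0 supplies infinitely many evaluation points; a functional reduces the claim to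
  polynomials over the field.
\<close>

lemma (in vector_space) polynomial_coeffs_zero:
  fixes c :: "nat \<Rightarrow> 'b"
  assumes zero: "\<And>t. (\<Sum>i<N. scale (of_nat t ^ i) (c i)) = 0" and i: "i < N"
    and char_0: "inj (of_nat :: nat \<Rightarrow> 'a)"
  shows "c i = 0"
proof (rule ccontr)
  assume "c i \<noteq> 0"
  then obtain \<phi> where \<phi>: "Vector_Spaces.linear scale (*) \<phi>" "\<phi> (c i) = 1"
    using separating_functional[OF subspace_single_0, of "c i"] by auto
  interpret \<phi>: Vector_Spaces.linear scale "(*)" \<phi> by fact
  define p where "p = (\<Sum>i<N. monom (\<phi> (c i)) i)"
  have "poly p (of_nat t) = \<phi> (\<Sum>i<N. scale (of_nat t ^ i) (c i))" for t
    by (simp add: p_def poly_sum poly_monom \<phi>.sum \<phi>.scale mult.commute)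
  then have "range of_nat \<subseteq> {x. poly p x = 0}" using zero \<phi>.zero by auto
  moreover have "infinite (range (of_nat :: nat \<Rightarrow> 'a))" using char_0 by (simp add: finite_image_iff)
  ultimately have "p = 0" using poly_roots_finite finite_subset by blast
  then have "coeff p i = 0" by simp
  then show False using i \<phi>(2) by (simp add: p_def coeff_sum)
qed

locale connected_bialgebra = convolution scale \<Delta> \<epsilon> scale
  for scale :: "'k::field_char_0 \<Rightarrow> 'h::comm_ring_1 \<Rightarrow> 'h"
    and \<Delta> :: "'h \<Rightarrow> ('h \<times> 'h \<Rightarrow>\<^sub>0 'k) set"
    and \<epsilon> :: "'h \<Rightarrow> 'k" +
  assumes connected: "connected_coalgebra scale \<Delta>"
begin

definition aug_proj :: "'h \<Rightarrow> 'h"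
  where "aug_proj x = x - conv_unit x"

text \<open>
  \<open>log(1 + J)\<close> for \<open>J = aug_proj\<close>, that is, the convolution logarithm of \<open>id\<close>.  It is the first Eulerian
  idempotent of \<open>H\<close>.
\<close>

definition log_id :: "'h \<Rightarrow> 'h"
  where "log_id = fps_at aug_proj (fps_ln 1)"

lemma lin_aug_proj: "lin aug_proj"
  using lin_conv_unit by (simp add: aug_proj_def Vector_Spaces.linear_iff algebra_simps)

lemma aug_proj_one [simp]: "aug_proj 1 = 0"
  by (simp add: aug_proj_def)

lemma nilpotent_aug_proj: "locally_nilpotent aug_proj"
  by (rule locally_nilpotent_of_connected[OF connected lin_aug_proj aug_proj_one])

lemma lin_log_id: "lin log_id"
  unfolding log_id_def by (rule lin_fps_at[OF nilpotent_aug_proj])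

lemma nilpotent_log_id: "locally_nilpotent log_id"
  unfolding log_id_def by (rule fps_at_compose(1)[OF nilpotent_aug_proj]) simp

lemma fps_at_log_id: "fps_at log_id F = fps_at aug_proj (F oo fps_ln 1)"
  unfolding log_id_def by (rule fps_at_compose(2)[OF nilpotent_aug_proj]) simp

text \<open>
  \<open>id\<^sup>t = (1 + J)\<^sup>t = exp(log(1 + J))\<^sup>t = exp(t \<cdot> log(1 + J))\<close>.
\<close>

lemma conv_pow_id_eq_exp: "conv_pow id t = fps_at log_id (fps_exp (of_nat t))"
proof -
  have id: "fps_at aug_proj (1 + fps_X) = id"
    by (rule ext) (simp add: fps_at_one_plus_X[OF nilpotent_aug_proj] aug_proj_def)
  have "conv_pow id t = fps_at aug_proj ((1 + fps_X) ^ t)"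
    by (simp add: fps_at_power[OF nilpotent_aug_proj] id)
  also have "(1 + fps_X) ^ t = (fps_exp 1 ^ t) oo fps_ln (1 :: 'k)"
    by (simp add: fps_exp_compose_ln[symmetric] fps_compose_power)
  also have "\<dots> = fps_exp (of_nat t) oo fps_ln 1"
    by (simp add: fps_exp_power_mult)
  finally show ?thesis unfolding fps_at_log_id .
qed

definition exp_term :: "nat \<Rightarrow> 'h \<Rightarrow> 'h"
  where "exp_term i x = scale (1 / fact i) (conv_pow log_id i x)"

text \<open>
  At each \<open>x\<close> the powers of the identity are polynomial in the exponent, with \<open>log_id x\<close> as the linear
  coefficient.
\<close>

lemma conv_pow_id_expansion:
  assumes "\<And>m. N \<le> m \<Longrightarrow> conv_pow log_id m x = 0"
  shows "conv_pow id t x = (\<Sum>i<N. scale (of_nat t ^ i) (exp_term i x))"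
proof -
  have "conv_pow id t x = (\<Sum>i<N. scale (fps_exp (of_nat t) $ i) (conv_pow log_id i x))"
    unfolding conv_pow_id_eq_exp by (rule fps_at_eq) (rule assms)
  then show ?thesis by (simp add: exp_term_def)
qed

lemma scale_of_nat_power: "scale (of_nat t ^ i) x = of_nat t ^ i * x"
proof -
  have 1: "scale (of_nat t) y = of_nat t * y" for y
    by (induction t) (simp_all add: scale_left_distrib algebra_simps)
  show ?thesis
  proof (induction i)
    case (Suc i)
    have "scale (of_nat t ^ Suc i) x = scale (of_nat t) (scale (of_nat t ^ i) x)" by simp
    also have "\<dots> = of_nat t ^ Suc i * x" unfolding 1 Suc by simp
    finally show ?case .
  qed simp
qed

lemma poly_zero_of_nat:
  fixes q :: "'h poly"
  assumes "\<And>t. poly q (of_nat t) = 0"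
  shows "q = 0"
proof (rule poly_eqI)
  fix i
  have "(\<Sum>i<Suc (degree q). scale (of_nat t ^ i) (coeff q i)) = 0" for t
    using assms[of t] by (simp only: poly_altdef scale_of_nat_power lessThan_Suc_atMost mult.commute)
  then have "coeff q i = 0" if "i < Suc (degree q)"
    by (rule polynomial_coeffs_zero) (rule that inj_of_nat)+
  then show "coeff q i = coeff 0 i" by (cases "i \<le> degree q") (auto simp: coeff_eq_0)
qed

text \<open>
  \<open>id\<^sup>t(xy) = id\<^sup>t(x) id\<^sup>t(y)\<close> holds for all natural \<open>t\<close>, hence as an identity of polynomials in \<open>t\<close> with
  coefficients in \<open>H\<close>; the linear coefficients give the claim.
\<close>

lemma log_id_derivation: "log_id (x * y) = conv_unit x * log_id y + log_id x * conv_unit y"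
proof -
  obtain N where N: "\<And>z m. z \<in> {x, y, x * y} \<Longrightarrow> N \<le> m \<Longrightarrow> conv_pow log_id m z = 0"
    using locally_nilpotent_uniform[OF nilpotent_log_id, of "{x, y, x * y}"] by blast
  define q where "q z = (\<Sum>i<N. monom (exp_term i z) i)" for z
  have coeff_q: "coeff (q z) i = exp_term i z" if "z \<in> {x, y, x * y}" for z i
    using N[OF that, of i] by (cases "i < N") (auto simp: q_def coeff_sum exp_term_def)
  have poly_q: "poly (q z) (of_nat t) = conv_pow id t z" if "z \<in> {x, y, x * y}" for z t
    using N[OF that]
    by (simp add: conv_pow_id_expansion[of N] q_def poly_sum poly_monom scale_of_nat_power mult.commute)
  let ?d = "q (x * y) - q x * q y"
  have "conv_pow id t (x * y) = conv_pow id t x * conv_pow id t y" for t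
    by (rule conv_pow_multiplicative) (simp_all add: linear_id)
  then have "?d = 0" by (intro poly_zero_of_nat) (simp add: poly_q)
  then have "coeff ?d 1 = 0" by simp
  then have "exp_term 1 (x * y) = exp_term 0 x * exp_term 1 y + exp_term 1 x * exp_term 0 y"
    by (simp add: coeff_mult coeff_q)
  then show ?thesis
    by (simp add: exp_term_def conv_unit_right lin_log_id)
qed

lemma id_eq_exp_log:
  assumes "\<And>m. N \<le> m \<Longrightarrow> conv_pow log_id m x = 0"
  shows "x = (\<Sum>i<N. exp_term i x)"
proof -
  have "conv_pow id 1 x = (\<Sum>i<N. scale (of_nat 1 ^ i) (exp_term i x))"
    by (rule conv_pow_id_expansion) (rule assms)
  then show ?thesis by (simp add: conv_unit_right linear_id)
qed

lemma counit_conv: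
  assumes "\<And>a. \<epsilon> (f a) = 0"
  shows "\<epsilon> (conv f g x) = 0"
  unfolding conv_def linear_sweedler[OF functional_counit]
  by (simp add: counit_mult assms sweedler_def lin_ext_def)

lemma counit_log_id [simp]: "\<epsilon> (log_id x) = 0"
proof -
  interpret e: Vector_Spaces.linear scale "(*)" \<epsilon> by (rule functional_counit)
  have J: "\<epsilon> (aug_proj a) = 0" for a
    by (simp add: aug_proj_def conv_unit_def e.diff e.scale counit_one)
  have "\<epsilon> (scale (fps_ln 1 $ n) (conv_pow aug_proj n x)) = 0" for n
    by (cases n) (simp_all add: e.scale counit_conv[OF J])
  then show ?thesis by (simp add: log_id_def fps_at_def e.sum)
qed

lemma log_id_one [simp]: "log_id 1 = 0"
  using log_id_derivation[of 1 1] by simp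

lemma log_id_conv:
  assumes "\<And>a. \<epsilon> (f a) = 0" "\<And>a. \<epsilon> (g a) = 0"
  shows "log_id (conv f g x) = 0"
  unfolding conv_def linear_sweedler[OF lin_log_id]
  by (simp add: log_id_derivation assms sweedler_def lin_ext_def)

text \<open>
  In \<open>x = \<Sum> e\<^sup>i(x) / i!\<close> the map \<open>e\<close> kills the term \<open>i = 0\<close>, a multiple of \<open>1\<close>, and the terms \<open>i \<ge> 2\<close>,
  which are sums of products of two elements of \<open>ker \<epsilon>\<close>.
\<close>

lemma log_id_idem: "log_id (log_id x) = log_id x"
proof -
  interpret e: Vector_Spaces.linear scale scale log_id by (rule lin_log_id)
  obtain N where N: "\<And>m. N \<le> m \<Longrightarrow> conv_pow log_id m x = 0"
    using nilpotent_log_id unfolding locally_nilpotent_def by metis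
  have "log_id (exp_term (Suc (Suc i)) x) = 0" for i
    unfolding exp_term_def e.scale conv_pow.simps(2)[of _ "Suc i"]
    by (subst log_id_conv) (simp_all add: counit_conv)
  moreover have "log_id (exp_term 0 x) = 0" by (simp add: exp_term_def conv_unit_def e.scale)
  moreover have "log_id x = log_id (\<Sum>i<Suc (Suc N). exp_term i x)"
    using N by (subst id_eq_exp_log[of "Suc (Suc N)" x]) auto
  ultimately have "log_id x = log_id (exp_term (Suc 0) x)"
    by (simp add: sum.lessThan_Suc_shift e.add e.sum del: sum.lessThan_Suc)
  then show ?thesis by (simp add: exp_term_def conv_unit_right lin_log_id)
qed

end

section \<open>Monomials and derivations\<close>

lemma fscale_eq_mult: "fscale c p = Poly_Mapping.single 0 c * p"
  for p :: "'m::comm_monoid_add \<Rightarrow>\<^sub>0 'k::field"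
  unfolding fscale_def by (rule mult_map_scale_conv_mult)

lemma unital_algebra_fscale:
  "unital_algebra (fscale :: 'k::field \<Rightarrow> ('m::comm_monoid_add \<Rightarrow>\<^sub>0 'k) \<Rightarrow> _)"
  by (intro unital_algebra.intro vector_space_fscale unital_algebra_axioms.intro)
    (simp_all add: fscale_eq_mult ac_simps)

definition mdegree :: "('x \<Rightarrow>\<^sub>0 nat) \<Rightarrow> nat"
  where "mdegree m = (\<Sum>x\<in>Poly_Mapping.keys m. Poly_Mapping.lookup m x)"

text \<open>
  The value of the monomial \<open>m\<close> when each variable \<open>x\<close> is given the value \<open>f x\<close>.
\<close>

definition monomial_value :: "('x \<Rightarrow>\<^sub>0 nat) \<Rightarrow> ('x \<Rightarrow> 'a::comm_monoid_mult) \<Rightarrow> 'a"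
  where "monomial_value m f = (\<Prod>x\<in>Poly_Mapping.keys m. f x ^ Poly_Mapping.lookup m x)"

lemma mdegree_zero [simp]: "mdegree 0 = 0"
  by (simp add: mdegree_def)

lemma mdegree_add: "mdegree (m + m') = mdegree m + mdegree m'"
proof -
  let ?A = "Poly_Mapping.keys m \<union> Poly_Mapping.keys m'"
  have *: "mdegree l = (\<Sum>x\<in>?A. Poly_Mapping.lookup l x)" if "Poly_Mapping.keys l \<subseteq> ?A" for l
    unfolding mdegree_def using that by (intro sum.mono_neutral_left) (auto simp: in_keys_iff)
  show ?thesis
    using keys_add[of m m'] by (simp add: * lookup_add sum.distrib)
qed

lemma mdegree_single [simp]: "mdegree (Poly_Mapping.single x n) = n"
  by (simp add: mdegree_def)

lemma mdegree_eq_0: "mdegree m = 0 \<longleftrightarrow> m = 0"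
  by (auto simp: mdegree_def in_keys_iff intro!: poly_mapping_eqI)

lemma monomial_value_zero [simp]: "monomial_value 0 f = 1"
  by (simp add: monomial_value_def)

lemma monomial_value_single [simp]: "monomial_value (Poly_Mapping.single x n) f = f x ^ n"
  by (simp add: monomial_value_def)

lemma monomial_value_add: "monomial_value (m + m') f = monomial_value m f * monomial_value m' f"
proof -
  let ?A = "Poly_Mapping.keys m \<union> Poly_Mapping.keys m'"
  have *: "monomial_value l f = (\<Prod>x\<in>?A. f x ^ Poly_Mapping.lookup l x)"
    if "Poly_Mapping.keys l \<subseteq> ?A" for l
    unfolding monomial_value_def using that
    by (intro prod.mono_neutral_left) (auto simp: in_keys_iff)
  show ?thesis
    using keys_add[of m m'] by (simp add: * lookup_add power_add prod.distrib)
qed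

lemma monomial_split:
  assumes "x \<in> Poly_Mapping.keys m"
  obtains m' where "m = m' + Poly_Mapping.single x (1::nat)" "Poly_Mapping.keys m' \<subseteq> Poly_Mapping.keys m"
proof
  let ?m' = "m - Poly_Mapping.single x 1"
  show "m = ?m' + Poly_Mapping.single x 1"
    using assms by (intro poly_mapping_eqI) (auto simp: lookup_add lookup_minus lookup_single when_def in_keys_iff)
  show "Poly_Mapping.keys ?m' \<subseteq> Poly_Mapping.keys m"
    by (auto simp: in_keys_iff lookup_minus)
qed

context convolution
begin

text \<open>
  Distribute \<open>n\<close> copies of the derivation over the factors of the monomial.  A factor that receives
  no copy contributes its counit, which is zero; so a nonzero term must give each factor exactly one
  copy, and there are \<open>n!\<close> ways to do this if \<open>n\<close> is the degree.
\<close>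

lemma conv_pow_derivation_monomial:
  assumes f: "lin f" and der: "\<And>x y. f (x * y) = conv_unit x * f y + f x * conv_unit y"
    and \<epsilon>: "\<And>b. b \<in> Poly_Mapping.keys m \<Longrightarrow> \<epsilon> b = 0" and n: "n \<le> mdegree m"
  shows "conv_pow f n (monomial_value m id) = (if n = mdegree m then of_nat (fact n) * monomial_value m f else 0)"
  using \<epsilon> n
proof (induction "mdegree m" arbitrary: m n)
  case 0
  then have "m = 0" by (simp add: mdegree_eq_0)
  then show ?case using 0 by simp
next
  case (Suc d)
  then obtain b where b: "b \<in> Poly_Mapping.keys m"
    by (metis Zero_not_Suc all_not_in_conv keys_eq_empty mdegree_zero)
  obtain m' where m': "m = m' + Poly_Mapping.single b 1" "Poly_Mapping.keys m' \<subseteq> Poly_Mapping.keys m"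
    using monomial_split[OF b] .
  have d: "d = mdegree m'" using Suc.hyps(2) m'(1) by (simp add: mdegree_add)
  have "conv_unit b = 0" using Suc.prems(1)[OF b] by (simp add: conv_unit_def)
  then have b0: "conv_pow f 0 b = 0" by simp
  have IH: "conv_pow f i (monomial_value m' id) = (if i = d then of_nat (fact i) * monomial_value m' f else 0)"
    if "i \<le> d" for i
    unfolding d by (rule Suc.hyps(1)[OF d]) (use that Suc.prems m'(2) d in auto)
  let ?t = "\<lambda>i. of_nat (n choose i) * (conv_pow f i (monomial_value m' id) * conv_pow f (n - i) b)"
  have sum: "conv_pow f n (monomial_value m id) = (\<Sum>i\<le>n. ?t i)"
    unfolding m'(1) monomial_value_add by (simp add: conv_pow_derivation[OF f der])
  \<comment> \<open>Splitting off one factor \<open>b\<close>: it must receive one copy, and the remaining \<open>d\<close> factors \<open>d\<close> copies.\<close>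
  have t0: "?t i = 0" if "i \<le> n" "\<not> (i = d \<and> n = Suc d)" for i
  proof (cases "i < d")
    case True
    then show ?thesis using IH[of i] by simp
  next
    case False
    then have "i = n" using that Suc.prems(2) Suc.hyps(2) by linarith
    then show ?thesis using b0 by simp
  qed
  show ?case
  proof (cases "n = Suc d")
    case True
    have "(\<Sum>i\<le>n. ?t i) = (\<Sum>i\<in>{d}. ?t i)"
      using t0 True by (intro sum.mono_neutral_right) auto
    also have "\<dots> = of_nat (fact n) * monomial_value m f"
      using True IH[of d] m'(1)
      by (simp add: monomial_value_add conv_unit_right f algebra_simps)
    finally show ?thesis using sum True Suc.hyps(2) by simp
  next
    case False
    then have "(\<Sum>i\<le>n. ?t i) = 0" using t0 by (intro sum.neutral) auto
    then show ?thesis using sum False Suc.hyps(2) by simp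
  qed
qed

end

section \<open>Evaluation of polynomials on a basis of the logarithm\<close>

lemma one_in_polynomials_in: "1 \<in> polynomials_in X"
  by (simp add: polynomials_in_def)

lemma mult_in_polynomials_in:
  assumes "p \<in> polynomials_in X" "q \<in> polynomials_in X"
  shows "p * q \<in> polynomials_in X"
  unfolding polynomials_in_def
proof (intro CollectI ballI)
  fix m assume "m \<in> Poly_Mapping.keys (p * q)"
  then obtain a b where "m = a + b" "a \<in> Poly_Mapping.keys p" "b \<in> Poly_Mapping.keys q"
    using keys_mult[of p q] by blast
  then show "Poly_Mapping.keys m \<subseteq> X"
    using assms keys_add[of a b] by (fastforce simp: polynomials_in_def)
qed

lemma subspace_polynomials_in:
  "module.subspace (fscale :: 'k::field \<Rightarrow> (('x \<Rightarrow>\<^sub>0 nat) \<Rightarrow>\<^sub>0 'k) \<Rightarrow> _) (polynomials_in X)"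
proof -
  interpret F: vector_space "fscale :: 'k \<Rightarrow> (('x \<Rightarrow>\<^sub>0 nat) \<Rightarrow>\<^sub>0 'k) \<Rightarrow> _" by simp
  show ?thesis
    unfolding F.subspace_def
  proof (intro conjI ballI allI)
    fix p q :: "('x \<Rightarrow>\<^sub>0 nat) \<Rightarrow>\<^sub>0 'k" and c :: 'k
    assume p: "p \<in> polynomials_in X"
    have "Poly_Mapping.keys (fscale c p) \<subseteq> Poly_Mapping.keys p"
      by (auto simp: in_keys_iff)
    then show "fscale c p \<in> polynomials_in X"
      using p by (auto simp: polynomials_in_def)
    assume q: "q \<in> polynomials_in X"
    show "p + q \<in> polynomials_in X"
      unfolding polynomials_in_def
    proof (intro CollectI ballI)
      fix m assume "m \<in> Poly_Mapping.keys (p + q)"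
      then have "m \<in> Poly_Mapping.keys p \<or> m \<in> Poly_Mapping.keys q"
        using keys_add[of p q] by blast
      then show "Poly_Mapping.keys m \<subseteq> X" using p q by (auto simp: polynomials_in_def)
    qed
  qed (simp add: polynomials_in_def)
qed

lemma (in vector_space) independent_linear_extension:
  assumes t: "vector_space t" and B: "independent B"
  obtains g where "Vector_Spaces.linear scale t g" "\<forall>b\<in>B. g b = f b"
proof -
  interpret vector_space_pair scale t
    by (rule vector_space_pair.intro[OF vector_space_axioms t])
  have "\<exists>g. Vector_Spaces.linear scale t g \<and> (\<forall>b\<in>B. g b = f b)"
    by (rule linear_independent_extend[OF B])
  then show thesis using that by auto
qed

context connected_bialgebra
begin

definition poly_eval :: "(('h \<Rightarrow>\<^sub>0 nat) \<Rightarrow>\<^sub>0 'k) \<Rightarrow> 'h"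
  where "poly_eval = lin_ext scale (\<lambda>m. monomial_value m id)"

lemma linear_poly_eval: "Vector_Spaces.linear fscale scale poly_eval"
  by (simp add: poly_eval_def)

lemma poly_eval_pure [simp]: "poly_eval (pure m) = monomial_value m id"
  by (simp add: poly_eval_def)

lemma poly_eval_one [simp]: "poly_eval 1 = 1"
  using poly_eval_pure[of 0] by (simp del: poly_eval_pure)

lemma poly_eval_mult: "poly_eval (p * q) = poly_eval p * poly_eval q"
proof -
  interpret e: Vector_Spaces.linear fscale scale poly_eval by (rule linear_poly_eval)
  interpret F: unital_algebra "fscale :: 'k \<Rightarrow> (('h \<Rightarrow>\<^sub>0 nat) \<Rightarrow>\<^sub>0 'k) \<Rightarrow> _"
    by (rule unital_algebra_fscale)
  have 1: "poly_eval (pure m * q) = poly_eval (pure m) * poly_eval q" for m q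
    by (rule linear_free_ext[of scale _ _ q])
      (simp_all add: Vector_Spaces.linear_iff e.add e.scale distrib_left scale_mult_right
        F.scale_mult_right mult_single monomial_value_add)
  show ?thesis
    by (rule linear_free_ext[of scale _ _ p])
      (simp_all add: Vector_Spaces.linear_iff e.add e.scale distrib_right scale_mult_left
        F.scale_mult_left 1 del: poly_eval_pure)
qed

text \<open>
  The range of the evaluation is a subalgebra that contains every \<open>log_id x\<close>, hence every value of
  a convolution power of \<open>log_id\<close>, hence \<open>x = \<Sum> log_id\<^sup>i(x) / i!\<close>.
\<close>

lemma poly_eval_surjective:
  assumes B: "range log_id \<subseteq> span B"
  shows "poly_eval ` polynomials_in B = UNIV"
proof -
  let ?W = "poly_eval ` polynomials_in B"
  interpret e: Vector_Spaces.linear fscale scale poly_eval by (rule linear_poly_eval)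
  have W: "subspace ?W" by (rule e.subspace_image[OF subspace_polynomials_in])
  have one: "1 \<in> ?W" using one_in_polynomials_in poly_eval_one by (metis image_eqI)
  have mult: "x * y \<in> ?W" if xy: "x \<in> ?W" "y \<in> ?W" for x y
  proof -
    obtain p q where pq: "p \<in> polynomials_in B" "q \<in> polynomials_in B" "x = poly_eval p" "y = poly_eval q"
      using xy by blast
    show ?thesis
      unfolding pq(3,4) poly_eval_mult[symmetric] by (intro imageI mult_in_polynomials_in pq)
  qed
  have "b \<in> ?W" if "b \<in> B" for b
  proof -
    have "pure (Poly_Mapping.single b 1) \<in> (polynomials_in B :: (('h \<Rightarrow>\<^sub>0 nat) \<Rightarrow>\<^sub>0 'k) set)"
      using that by (simp add: polynomials_in_def)
    then show ?thesis
      by (rule rev_image_eqI) simp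
  qed
  then have log: "log_id x \<in> ?W" for x
    using B span_minimal[OF _ W] by blast
  have pow: "conv_pow log_id n x \<in> ?W" for n x
  proof (induction n arbitrary: x)
    case 0
    show ?case using subspace_scale[OF W one] by (simp add: conv_unit_def)
  next
    case (Suc n)
    show ?case
      unfolding conv_pow.simps conv_def sweedler_def
      by (rule lin_ext_in_subspace[OF W]) (auto intro: mult log Suc)
  qed
  have "x \<in> ?W" for x
  proof -
    obtain N where N: "\<And>m. N \<le> m \<Longrightarrow> conv_pow log_id m x = 0"
      using nilpotent_log_id unfolding locally_nilpotent_def by metis
    have "(\<Sum>i<N. exp_term i x) \<in> ?W"
      unfolding exp_term_def by (intro subspace_sum[OF W] subspace_scale[OF W] pow)
    moreover have "x = (\<Sum>i<N. exp_term i x)" by (rule id_eq_exp_log) (rule N)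
    ultimately show ?thesis by simp
  qed
  then show ?thesis by blast
qed

text \<open>
  The derivation \<open>\<delta>\<close> sends each \<open>b \<in> B\<close> to its own variable.  Its \<open>n\<close>-th convolution power, with \<open>n\<close> the
  lowest degree of a monomial in \<open>p\<close>, maps \<open>poly_eval p\<close> to \<open>n!\<close> times the homogeneous component of
  degree \<open>n\<close> of \<open>p\<close>.
\<close>

lemma poly_eval_kernel:
  assumes B: "B \<subseteq> range log_id" "independent B"
    and p: "p \<in> polynomials_in B" "poly_eval p = 0"
  shows "p = 0"
proof (rule ccontr)
  interpret P: convolution scale \<Delta> \<epsilon> "fscale :: 'k \<Rightarrow> (('h \<Rightarrow>\<^sub>0 nat) \<Rightarrow>\<^sub>0 'k) \<Rightarrow> _"
    by (rule convolution.intro[OF bialgebra_axioms unital_algebra_fscale])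
  obtain \<iota> :: "'h \<Rightarrow> (('h \<Rightarrow>\<^sub>0 nat) \<Rightarrow>\<^sub>0 'k)" where \<iota>: "Vector_Spaces.linear scale fscale \<iota>"
      "\<forall>b\<in>B. \<iota> b = pure (Poly_Mapping.single b (1::nat))"
    by (rule independent_linear_extension[OF vector_space_fscale B(2),
        of "\<lambda>b. pure (Poly_Mapping.single b (1::nat))"])
  define \<delta> where "\<delta> x = \<iota> (log_id x)" for x
  have lin: "P.lin \<delta>"
    using \<iota>(1) lin_log_id by (simp add: \<delta>_def Vector_Spaces.linear_iff)
  have der: "\<delta> (x * y) = P.conv_unit x * \<delta> y + \<delta> x * P.conv_unit y" for x y
    using \<iota>(1) by (simp add: \<delta>_def log_id_derivation Vector_Spaces.linear_iff)
  have B_log: "log_id b = b" if "b \<in> B" for b using that B(1) log_id_idem by auto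
  have B_\<epsilon>: "\<epsilon> b = 0" if "b \<in> B" for b using that B(1) counit_log_id by auto
  have mono: "monomial_value m \<delta> = pure m" if "Poly_Mapping.keys m \<subseteq> B" for m
    using that
  proof (induction "mdegree m" arbitrary: m)
    case 0
    then have "m = 0" by (simp add: mdegree_eq_0)
    then show ?case by simp
  next
    case (Suc d)
    then obtain b where b: "b \<in> Poly_Mapping.keys m"
      by (metis Zero_not_Suc all_not_in_conv keys_eq_empty mdegree_zero)
    obtain m' where m': "m = m' + Poly_Mapping.single b 1" "Poly_Mapping.keys m' \<subseteq> Poly_Mapping.keys m"
      using monomial_split[OF b] .
    have "\<delta> b = pure (Poly_Mapping.single b 1)" using b Suc.prems by (auto simp: \<delta>_def B_log \<iota>(2))
    moreover have "monomial_value m' \<delta> = pure m'"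
      using Suc.hyps m' Suc.prems by (auto simp: mdegree_add)
    ultimately show ?case
      unfolding m'(1) monomial_value_add by (simp add: mult_single)
  qed
  assume "p \<noteq> 0"
  then have ne: "mdegree ` Poly_Mapping.keys p \<noteq> {}" by (simp add: keys_eq_empty)
  define n where "n = Min (mdegree ` Poly_Mapping.keys p)"
  obtain m0 where m0: "m0 \<in> Poly_Mapping.keys p" "mdegree m0 = n"
    using Min_in[OF _ ne] by (auto simp: n_def)
  let ?D = "P.conv_pow \<delta> n"
  have D: "?D (monomial_value m id) = (if n = mdegree m then fscale (fact n) (pure m) else 0)"
    if "m \<in> Poly_Mapping.keys p" for m
  proof -
    have "Poly_Mapping.keys m \<subseteq> B" using p(1) that by (auto simp: polynomials_in_def)
    moreover have "n \<le> mdegree m" using that by (simp add: n_def)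
    moreover have "of_nat (fact n) * pure m = fscale (fact n) (pure m :: ('h \<Rightarrow>\<^sub>0 nat) \<Rightarrow>\<^sub>0 'k)"
      by (simp add: fscale_eq_mult single_of_nat[symmetric] del: single_of_nat)
    ultimately show ?thesis
      using P.conv_pow_derivation_monomial[OF lin der, of m n] B_\<epsilon> mono by (auto simp: subset_iff)
  qed
  have "0 = ?D (poly_eval p)"
    using p(2) linear_map_zero[OF P.lin_conv_pow[OF lin]] by simp
  also have "\<dots> = lin_ext fscale (\<lambda>m. ?D (monomial_value m id)) p"
    unfolding poly_eval_def by (rule linear_of_lin_ext[OF P.lin_conv_pow[OF lin]])
  also have "Poly_Mapping.lookup \<dots> m0 = (\<Sum>m\<in>Poly_Mapping.keys p.
      Poly_Mapping.lookup p m * (if m = m0 then fact n else 0))"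
    unfolding lin_ext_def lookup_sum using m0
    by (intro sum.cong) (auto simp: D lookup_single when_def)
  also have "\<dots> = Poly_Mapping.lookup p m0 * fact n"
    using m0(1) by (simp add: if_distrib cong: if_cong)
  finally show False using m0(1) by (simp add: in_keys_iff)
qed

lemma poly_eval_injective:
  assumes B: "B \<subseteq> range log_id" "independent B"
  shows "inj_on poly_eval (polynomials_in B)"
proof (rule inj_onI)
  interpret e: Vector_Spaces.linear fscale scale poly_eval by (rule linear_poly_eval)
  fix p q assume "p \<in> polynomials_in B" "q \<in> polynomials_in B" "poly_eval p = poly_eval q"
  then show "p = q"
    using poly_eval_kernel[OF B, of "p - q"] e.vs1.subspace_diff[OF subspace_polynomials_in]
    by (simp add: e.diff)
qed

lemma algebra_iso_poly_eval:
  assumes "B \<subseteq> range log_id" "independent B" "range log_id \<subseteq> span B"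
  shows "algebra_iso_polynomials scale B poly_eval"
proof -
  interpret e: Vector_Spaces.linear fscale scale poly_eval by (rule linear_poly_eval)
  show ?thesis
    using poly_eval_injective[OF assms(1,2)] poly_eval_surjective[OF assms(3)]
    by (simp add: algebra_iso_polynomials_def bij_betw_def poly_eval_mult e.add e.scale)
qed

end

theorem proposition3p6:
  fixes scale :: "'k::field_char_0 \<Rightarrow> 'h::comm_ring_1 \<Rightarrow> 'h"
    and \<Delta> :: "'h \<Rightarrow> ('h \<times> 'h \<Rightarrow>\<^sub>0 'k) set"
    and \<epsilon> :: "'h \<Rightarrow> 'k"
    and S :: "'h \<Rightarrow> 'h"
  assumes "hopf_algebra scale \<Delta> \<epsilon> S"
    and "connected_coalgebra scale \<Delta>"
  shows "\<exists>(X :: 'h set) \<phi>. algebra_iso_polynomials scale X \<phi>"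
proof -
  interpret H: hopf_algebra scale \<Delta> \<epsilon> S by fact
  interpret C: connected_bialgebra scale \<Delta> \<epsilon>
    by (intro connected_bialgebra.intro convolution.intro connected_bialgebra_axioms.intro
      H.bialgebra_axioms H.unital_algebra_axioms assms(2))
  obtain B where B: "B \<subseteq> range C.log_id" "H.independent B" "range C.log_id \<subseteq> H.span B"
    by (rule H.maximal_independent_subset)
  have "algebra_iso_polynomials scale B C.poly_eval"
    by (rule C.algebra_iso_poly_eval[OF B])
  then show ?thesis by blast
qed

end
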